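(* Let $n\ge 1$ be an integer, $a<b$ real numbers, $\alpha,\beta>-1$ and $\gamma\in\mathbb R$. Consider the weight $\rho(z)=(z-a)^\alpha(b-z)^\beta e^{\gamma z}$ on $[a,b]$ and set $$g(x):=\frac{\partial}{\partial x}\log\int_{[a,b]^n}\Delta^2(z)\prod_{k=1}^n e^{xz_k}\rho(z_k)\,dz_k ,\qquad x\in\mathbb R.$$ Then the function $$f(y)=n(n+\alpha+\beta)-\frac{y}{b-a}\Big(g\Big(-\frac{y}{b-a}-\gamma\Big)-na\Big)$$ satisfies, for $y\neq 0$, the following version of the Painlevé V equation: $$f''^2+\frac{4}{P^2}\Big((Pf'^2+Qf'+R)f'-(P'f'^2+Q'f'+R')f+\tfrac12(P''f'+Q'')f^2-\tfrac16P'''f^3-\tfrac14\beta^2n^2\Big)=0,$$ where $$P(y)=y,\qquad 4Q(y)=-y^2+2y(2n+\alpha-\beta)-(\alpha+\beta)^2,\qquad 2R(y)=-\beta n(\alpha+\beta+y).$$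
   Context: $\Delta(z)=\prod_{1\le i<j\le n}(z_i-z_j)$ is the Vandermonde determinant in $z_1,\dots,z_n$. Primes denote derivatives with respect to $y$. *)

theory Defs
  imports "HOL-Analysis.Analysis"
begin

text \<open>Points of \<open>\<real>\<^sup>n\<close> are functions \<^typ>\<open>nat \<Rightarrow> real\<close> restricted to the index set \<open>{1..n}\<close>.\<close>

definition vandermonde :: "nat \<Rightarrow> (nat \<Rightarrow> real) \<Rightarrow> real" where
  "vandermonde n z = (\<Prod>j\<in>{1..n}. \<Prod>i\<in>{1..<j}. z i - z j)"

text \<open>Since \<open>0 powr c = 0\<close> for every \<open>c\<close>, the weight vanishes at both endpoints even for
  nonpositive exponents; this affects only a null set.\<close>

definition weight :: "real \<Rightarrow> real \<Rightarrow> real \<Rightarrow> real \<Rightarrow> real \<Rightarrow> real \<Rightarrow> real" where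
  "weight a b \<alpha> \<beta> \<gamma> z = (z - a) powr \<alpha> * (b - z) powr \<beta> * exp (\<gamma> * z)"

definition integrand ::
  "nat \<Rightarrow> real \<Rightarrow> real \<Rightarrow> real \<Rightarrow> real \<Rightarrow> real \<Rightarrow> real \<Rightarrow> (nat \<Rightarrow> real) \<Rightarrow> real" where
  "integrand n a b \<alpha> \<beta> \<gamma> x z =
     (vandermonde n z)\<^sup>2 * (\<Prod>k\<in>{1..n}. exp (x * z k) * weight a b \<alpha> \<beta> \<gamma> (z k))"

definition cube :: "nat \<Rightarrow> real \<Rightarrow> real \<Rightarrow> (nat \<Rightarrow> real) set" where
  "cube n a b = (\<Pi>\<^sub>E k\<in>{1..n}. {a..b})"

definition lebesgue_pow :: "nat \<Rightarrow> (nat \<Rightarrow> real) measure" where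
  "lebesgue_pow n = (\<Pi>\<^sub>M k\<in>{1..n}. lborel)"

definition partition_fun ::
  "nat \<Rightarrow> real \<Rightarrow> real \<Rightarrow> real \<Rightarrow> real \<Rightarrow> real \<Rightarrow> real \<Rightarrow> real" where
  "partition_fun n a b \<alpha> \<beta> \<gamma> x =
     set_lebesgue_integral (lebesgue_pow n) (cube n a b) (integrand n a b \<alpha> \<beta> \<gamma> x)"

definition g_fun ::
  "nat \<Rightarrow> real \<Rightarrow> real \<Rightarrow> real \<Rightarrow> real \<Rightarrow> real \<Rightarrow> real \<Rightarrow> real" where
  "g_fun n a b \<alpha> \<beta> \<gamma> x = deriv (\<lambda>t. ln (partition_fun n a b \<alpha> \<beta> \<gamma> t)) x"

definition f_fun ::
  "nat \<Rightarrow> real \<Rightarrow> real \<Rightarrow> real \<Rightarrow> real \<Rightarrow> real \<Rightarrow> real \<Rightarrow> real" where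
  "f_fun n a b \<alpha> \<beta> \<gamma> y =
     n * (n + \<alpha> + \<beta>) - y / (b - a) * (g_fun n a b \<alpha> \<beta> \<gamma> (- y / (b - a) - \<gamma>) - n * a)"

definition P_poly :: "real \<Rightarrow> real" where
  "P_poly y = y"

definition Q_poly :: "nat \<Rightarrow> real \<Rightarrow> real \<Rightarrow> real \<Rightarrow> real" where
  "Q_poly n \<alpha> \<beta> y = (- y\<^sup>2 + 2 * y * (2 * n + \<alpha> - \<beta>) - (\<alpha> + \<beta>)\<^sup>2) / 4"

definition R_poly :: "nat \<Rightarrow> real \<Rightarrow> real \<Rightarrow> real \<Rightarrow> real" where
  "R_poly n \<alpha> \<beta> y = - \<beta> * n * (\<alpha> + \<beta> + y) / 2"

text \<open>The equation
  \<open>f''\<^sup>2 + 4/P\<^sup>2 ((P f'\<^sup>2 + Q f' + R) f' - (P' f'\<^sup>2 + Q' f' + R') f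
     + 1/2 (P'' f' + Q'') f\<^sup>2 - 1/6 P''' f\<^sup>3 + c) = 0\<close> at the point \<open>y\<close>.
  The derivatives are those of \<^const>\<open>deriv\<close>, so differentiability of \<open>f\<close> and \<open>f'\<close>
  has to be stated separately.\<close>

definition painleve_eq_at ::
  "(real \<Rightarrow> real) \<Rightarrow> (real \<Rightarrow> real) \<Rightarrow> (real \<Rightarrow> real) \<Rightarrow> real \<Rightarrow> (real \<Rightarrow> real) \<Rightarrow> real \<Rightarrow> bool" where
  "painleve_eq_at P Q R c f y \<longleftrightarrow>
     (deriv (deriv f) y)\<^sup>2 + 4 / (P y)\<^sup>2 *
       ((P y * (deriv f y)\<^sup>2 + Q y * deriv f y + R y) * deriv f y
        - (deriv P y * (deriv f y)\<^sup>2 + deriv Q y * deriv f y + deriv R y) * f y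
        + 1 / 2 * (deriv (deriv P) y * deriv f y + deriv (deriv Q) y) * (f y)\<^sup>2
        - 1 / 6 * deriv (deriv (deriv P)) y * (f y) ^ 3
        + c) = 0"

end

(*
Substituting u = (z - a)/(b - a), the n-fold integral becomes a Hankel determinant of the
moments of u^alpha (1 - u)^beta e^(-y u) on [0,1] with y = -(b - a)(x + gamma), so by Heine's
formula it is, up to elementary factors, the product of the squared norms h_0, ..., h_(n-1) of
the monic orthogonal polynomials P_j for this weight.  Let a_j, b_j be the coefficients of
their three-term recurrence and p_n = -(a_0 + ... + a_(n-1)) the subleading coefficient of P_n.
Differentiating in y gives h_n' = -a_n h_n, p_n' = b_n and b_n' = b_n (a_(n-1) - a_n), and
f = n(n + alpha + beta) + y p_n.

Pearson's equation for the weight, applied to P_n^2 and P_n P_(n-1), gives two difference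
equations for a_n, b_n, p_n.  In terms of X_n = 2n + 1 + alpha + beta - y a_n and
phi_n = f' = p_n + y b_n they have two first integrals in n, both proved by induction:
  (2n + alpha + beta) p_n + n(n + alpha) = y b_n (X_n + X_(n-1) + y - (2n + alpha + beta)),
  b_n X_n X_(n-1) = phi_n (phi_n - beta).
Since f'' = b_n (X_n - X_(n-1)), eliminating X_n and X_(n-1) from
(X_n - X_(n-1))^2 = (X_n + X_(n-1))^2 - 4 X_n X_(n-1) yields the Painleve equation.
*)
theory Submission
  imports Defs "Jordan_Normal_Form.Determinant"
begin

hide_const (open) Module.smult

section \<open>Polynomials depending on a parameter\<close>

text \<open>Differentiation in the parameter, one coefficient at a time. No degree bound is built
  in; \<open>L_poly_deriv\<close> asks for one that is uniform in the parameter.\<close>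

definition has_poly_derivative :: "(real \<Rightarrow> real poly) \<Rightarrow> real poly \<Rightarrow> real \<Rightarrow> bool" where
  "has_poly_derivative F G y \<longleftrightarrow>
     (\<forall>i. ((\<lambda>t. coeff (F t) i) has_real_derivative coeff G i) (at y))"

lemma has_poly_derivative_const: "has_poly_derivative (\<lambda>t. p) 0 y"
  by (auto simp: has_poly_derivative_def)

lemma has_poly_derivative_diff:
  assumes "has_poly_derivative F G y" "has_poly_derivative F' G' y"
  shows "has_poly_derivative (\<lambda>t. F t - F' t) (G - G') y"
  using assms by (auto simp: has_poly_derivative_def intro!: derivative_eq_intros)

lemma has_poly_derivative_smult:
  assumes "has_poly_derivative F G y" "(c has_real_derivative c') (at y)"
  shows "has_poly_derivative (\<lambda>t. smult (c t) (F t)) (smult c' (F y) + smult (c y) G) y"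
  using assms by (auto simp: has_poly_derivative_def intro!: derivative_eq_intros)

lemma has_poly_derivative_pCons_0:
  assumes "has_poly_derivative F G y"
  shows "has_poly_derivative (\<lambda>t. pCons 0 (F t)) (pCons 0 G) y"
  using assms by (auto simp: has_poly_derivative_def coeff_pCons split: nat.split)

lemma has_poly_derivative_mult:
  assumes "has_poly_derivative F G y" "has_poly_derivative F' G' y"
  shows "has_poly_derivative (\<lambda>t. F t * F' t) (G * F' y + F y * G') y"
  unfolding has_poly_derivative_def
proof
  fix i
  have "((\<lambda>t. \<Sum>j\<le>i. coeff (F t) j * coeff (F' t) (i - j)) has_real_derivative
     (\<Sum>j\<le>i. coeff G j * coeff (F' y) (i - j) + coeff G' (i - j) * coeff (F y) j)) (at y)"
    using assms unfolding has_poly_derivative_def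
    by (intro DERIV_sum DERIV_mult) auto
  then show "((\<lambda>t. coeff (F t * F' t) i) has_real_derivative coeff (G * F' y + F y * G') i) (at y)"
    by (simp add: coeff_mult sum.distrib mult.commute[of _ "coeff (F y) _"])
qed

lemma poly_eq_sum_monom:
  fixes p :: "real poly"
  assumes "\<And>i. i > m \<Longrightarrow> coeff p i = 0"
  shows "p = (\<Sum>i\<le>m. smult (coeff p i) (monom 1 i))"
proof (rule poly_eqI)
  fix k
  have "coeff (\<Sum>i\<le>m. smult (coeff p i) (monom 1 i)) k = (\<Sum>i\<le>m. if k = i then coeff p i else 0)"
    unfolding coeff_sum by (rule sum.cong) auto
  also have "\<dots> = coeff p k" using assms[of k] by (simp add: sum.delta')
  finally show "coeff p k = coeff (\<Sum>i\<le>m. smult (coeff p i) (monom 1 i)) k" ..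
qed

text \<open>\<open>[:0, 1, -1:]\<close> is x(1 - x), the factor in Pearson's equation. Its x part
  contributes \<open>i * coeff p i\<close>, its -x^2 part the shifted term.\<close>

lemma coeff_sigma_pderiv:
  "coeff ([:0, 1, -1:] * pderiv p) i = real i * coeff p i - (real i - 1) * coeff p (i - 1)"
  if "i > 0" for p :: "real poly"
  using that by (cases i; cases "i - 1") (auto simp: coeff_pderiv algebra_simps coeff_pCons split: nat.split)

lemma quadratic_mult:
  "[:c0, c1, c2:] * p = smult c0 p + smult c1 (pCons 0 p) + smult c2 (pCons 0 (pCons 0 p))"
  for p :: "real poly"
  by (simp add: algebra_simps)

section \<open>Orthogonal polynomials of a semiclassical moment functional\<close>

text \<open>The model for \<open>L y p\<close> is the integral over [0,1] of p(u) w(u) with w(u) =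
  u^\<alpha> (1 - u)^\<beta> e^(-y u). Differentiating in y brings down -u, which is
  \<open>L_deriv\<close>; \<open>pearson\<close> says that (u(1 - u) p w)' integrates to 0, since
  u(1 - u) w'/w = \<alpha> - (\<alpha> + \<beta> + y) u + y u^2.\<close>

locale moment_functional =
  fixes L :: "real \<Rightarrow> real poly \<Rightarrow> real" and \<alpha> \<beta> :: real
  assumes L_add: "L y (p + q) = L y p + L y q"
    and L_smult: "L y (smult c p) = c * L y p"
    and L_pos: "p \<noteq> 0 \<Longrightarrow> L y (p * p) > 0"
    and L_deriv: "((\<lambda>t. L t p) has_real_derivative - L y (pCons 0 p)) (at y)"
    and pearson: "L y (pderiv ([:0, 1, -1:] * p) + [:\<alpha>, - (\<alpha> + \<beta> + y), y:] * p) = 0"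
begin

lemma L_0: "L y 0 = 0"
  using L_smult[of y 0 0] by simp

lemma L_minus: "L y (- p) = - L y p"
  using L_smult[of y "-1" p] by simp

lemma L_diff: "L y (p - q) = L y p - L y q"
  using L_add[of y p "- q"] by (simp add: L_minus)

lemma L_sum: "L y (\<Sum>i\<in>I. F i) = (\<Sum>i\<in>I. L y (F i))"
  by (induction I rule: infinite_finite_induct) (auto simp: L_0 L_add)

lemmas L_linear = L_0 L_minus L_add L_diff L_smult

text \<open>Product rule for a functional and an argument that both move with the parameter: the
  uniform bound \<open>m\<close> turns \<open>L t (F t)\<close> into a finite sum of coefficients
  times moments.\<close>

lemma L_poly_deriv:
  assumes F: "has_poly_derivative F G y" and deg: "\<And>t i. i > m \<Longrightarrow> coeff (F t) i = 0"
  shows "((\<lambda>t. L t (F t)) has_real_derivative L y G - L y (pCons 0 (F y))) (at y)"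
proof -
  have degG: "coeff G i = 0" if "i > m" for i
  proof -
    have "((\<lambda>t. coeff (F t) i) has_real_derivative coeff G i) (at y)"
      using F by (auto simp: has_poly_derivative_def)
    then have "((\<lambda>t. 0) has_real_derivative coeff G i) (at y)" by (simp add: deg[OF that])
    then show ?thesis using DERIV_const DERIV_unique by blast
  qed
  have expand: "L t p = (\<Sum>i\<le>m. coeff p i * L t (monom 1 i))" if "\<And>i. i > m \<Longrightarrow> coeff p i = 0" for t p
    by (subst poly_eq_sum_monom[OF that]) (simp_all add: L_sum L_smult)
  have "((\<lambda>t. \<Sum>i\<le>m. coeff (F t) i * L t (monom 1 i)) has_real_derivative
      (\<Sum>i\<le>m. coeff G i * L y (monom 1 i) + (- L y (pCons 0 (monom 1 i))) * coeff (F y) i)) (at y)"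
    using F unfolding has_poly_derivative_def by (intro DERIV_sum DERIV_mult L_deriv) auto
  moreover have "(\<Sum>i\<le>m. L y (pCons 0 (monom 1 i)) * coeff (F y) i)
      = L y (pCons 0 (\<Sum>i\<le>m. smult (coeff (F y) i) (monom 1 i)))"
  proof -
    have "pCons 0 (\<Sum>i\<le>m. smult (coeff (F y) i) (monom 1 i))
        = (\<Sum>i\<le>m. smult (coeff (F y) i) (pCons 0 (monom 1 i)))"
      by (rule poly_eqI) (simp add: coeff_pCons coeff_sum split: nat.split)
    then show ?thesis by (simp only: L_sum L_smult) (simp add: mult.commute)
  qed
  moreover have "(\<Sum>i\<le>m. smult (coeff (F y) i) (monom 1 i)) = F y"
    using poly_eq_sum_monom[OF deg] by metis
  ultimately show ?thesis
    by (simp add: expand[OF deg] expand[OF degG] sum.distrib sum_negf sum_subtractf)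
qed

section \<open>Monic orthogonal polynomials: recurrence and orthogonality\<close>

fun ortho_poly :: "real \<Rightarrow> nat \<Rightarrow> real poly" where
  "ortho_poly y 0 = 1"
| "ortho_poly y (Suc 0) = pCons 0 1 - smult (L y (pCons 0 1) / L y 1) 1"
| "ortho_poly y (Suc (Suc n)) =
     (let Q = ortho_poly y (Suc n); R = ortho_poly y n
      in pCons 0 Q - smult (L y (pCons 0 (Q * Q)) / L y (Q * Q)) Q
         - smult (L y (Q * Q) / L y (R * R)) R)"

definition sqnorm :: "real \<Rightarrow> nat \<Rightarrow> real" where
  "sqnorm y n = L y (ortho_poly y n * ortho_poly y n)"

definition rec_a :: "real \<Rightarrow> nat \<Rightarrow> real" where
  "rec_a y n = L y (pCons 0 (ortho_poly y n * ortho_poly y n)) / sqnorm y n"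

text \<open>With \<open>rec_b y 0 = 0\<close> the truncated index \<open>n - 1\<close> below is harmless at \<open>n = 0\<close>:
  it only occurs multiplied by \<open>rec_b y n\<close>.\<close>

definition rec_b :: "real \<Rightarrow> nat \<Rightarrow> real" where
  "rec_b y n = (if n = 0 then 0 else sqnorm y n / sqnorm y (n - 1))"

text \<open>The polynomials are built by the Stieltjes recurrence with coefficients computed from
  \<open>L\<close>; orthogonality is then a theorem, \<open>orthogonal_less\<close>. This form
  covers the first step too, where \<open>rec_b y 0 = 0\<close> removes the last term.\<close>

lemma ortho_poly_rec:
  "ortho_poly y (Suc n) = pCons 0 (ortho_poly y n) - smult (rec_a y n) (ortho_poly y n)
     - smult (rec_b y n) (ortho_poly y (n - 1))"
  by (cases n) (simp_all add: rec_a_def rec_b_def sqnorm_def Let_def)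

lemma pCons_ortho_poly:
  "pCons 0 (ortho_poly y n) = ortho_poly y (Suc n) + smult (rec_a y n) (ortho_poly y n)
     + smult (rec_b y n) (ortho_poly y (n - 1))"
  unfolding ortho_poly_rec by simp

lemma coeff_ortho_poly_gt_and_lead:
  "(\<forall>i>n. coeff (ortho_poly y n) i = 0) \<and> coeff (ortho_poly y n) n = 1"
proof (induction n rule: less_induct)
  case (less n)
  show ?case
  proof (cases n)
    case 0
    then show ?thesis by (simp add: coeff_1)
  next
    case (Suc k)
    have 1: "coeff (ortho_poly y k) i = 0" if "i > k" for i using less[of k] that Suc by auto
    have 2: "coeff (ortho_poly y k) k = 1" using less[of k] Suc by auto
    have 3: "coeff (ortho_poly y (k - 1)) i = 0" if "i > k" for i
      using less[of "k - 1"] that Suc by auto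
    show ?thesis unfolding Suc ortho_poly_rec
      by (auto simp: coeff_pCons 1 2 3[unfolded One_nat_def] split: nat.split)
  qed
qed

lemma coeff_ortho_poly_gt: "i > n \<Longrightarrow> coeff (ortho_poly y n) i = 0"
  and coeff_ortho_poly_lead [simp]: "coeff (ortho_poly y n) n = 1"
  using coeff_ortho_poly_gt_and_lead by auto

lemma degree_ortho_poly: "degree (ortho_poly y n) = n"
  by (rule antisym) (auto intro: degree_le le_degree simp: coeff_ortho_poly_gt)

lemma sqnorm_pos: "sqnorm y n > 0"
  unfolding sqnorm_def by (rule L_pos) (metis coeff_0 coeff_ortho_poly_lead zero_neq_one)

lemma sqnorm_Suc: "sqnorm y (Suc n) = rec_b y (Suc n) * sqnorm y n"
  using sqnorm_pos[of y n] by (simp add: rec_b_def)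

lemma L_pCons_mult_ortho_poly:
  "L y (pCons 0 (ortho_poly y n * r)) = L y (ortho_poly y (Suc n) * r)
     + rec_a y n * L y (ortho_poly y n * r) + rec_b y n * L y (ortho_poly y (n - 1) * r)"
proof -
  have "pCons 0 (ortho_poly y n * r) = pCons 0 (ortho_poly y n) * r" by simp
  then show ?thesis unfolding pCons_ortho_poly by (simp add: algebra_simps L_linear)
qed

text \<open>Strong induction on the larger degree m = n + 1. The choice of a_n handles k = n, the
  choice of b_n handles k = n - 1, and for smaller k every term of the recurrence vanishes by
  induction.\<close>

lemma orthogonal_less: "k < m \<Longrightarrow> L y (ortho_poly y m * ortho_poly y k) = 0"
proof (induction m arbitrary: k rule: less_induct)
  case (less m)
  then obtain n where m: "m = Suc n" by (cases m) auto
  let ?P = "ortho_poly y"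
  have IH: "L y (?P n * ?P j) = 0" if "j < n" for j using less.IH[of n j] that m by auto
  have sym: "L y (?P i * ?P j) = L y (?P j * ?P i)" for i j by (simp add: mult.commute)
  have step: "L y (?P m * ?P k) = L y (pCons 0 (?P n * ?P k)) - rec_a y n * L y (?P n * ?P k)
      - rec_b y n * L y (?P (n - 1) * ?P k)"
    unfolding m L_pCons_mult_ortho_poly by simp
  have "k = n \<or> (k < n \<and> Suc k = n) \<or> Suc k < n" using less.prems m by auto
  moreover have ?case if "k = n"
  proof (cases n)
    case 0
    then show ?thesis using step that sqnorm_pos[of y 0]
      by (simp add: rec_a_def rec_b_def sqnorm_def)
  next
    case (Suc i)
    then show ?thesis using step that sqnorm_pos[of y n] IH[of "n - 1"] sym[of n "n - 1"]
      by (simp add: rec_a_def sqnorm_def del: ortho_poly.simps)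
  qed
  moreover have ?case if "Suc k \<le> n"
  proof -
    \<comment> \<open>Multiplication by x is symmetric for \<open>L\<close>, so it may act on
      \<open>?P k\<close> instead; the recurrence at k leaves only the term in
      \<open>?P (Suc k)\<close>.\<close>
    have "L y (pCons 0 (?P n * ?P k)) = L y (pCons 0 (?P k * ?P n))" by (simp add: mult.commute)
    also have "\<dots> = L y (?P n * ?P (Suc k))"
      unfolding L_pCons_mult_ortho_poly
      using IH[of k] IH[of "k - 1"] that by (simp add: sym[of n] del: ortho_poly.simps)
    finally have x: "L y (pCons 0 (?P n * ?P k)) = L y (?P n * ?P (Suc k))" .
    show ?thesis
    proof (cases "Suc k = n")
      case True
      then show ?thesis using step x IH[of k] sqnorm_pos[of y k]
        by (auto simp: rec_b_def sqnorm_def simp del: ortho_poly.simps)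
    next
      case False
      then have "L y (?P (n - 1) * ?P k) = 0" "L y (?P n * ?P (Suc k)) = 0" "L y (?P n * ?P k) = 0"
        using less.IH[of "n - 1" k] IH that m by auto
      then show ?thesis using step x by simp
    qed
  qed
  ultimately show ?case by auto
qed

lemma L_ortho_poly_ortho_poly:
  "L y (ortho_poly y m * ortho_poly y k) = (if m = k then sqnorm y m else 0)"
  using orthogonal_less[of k m y] orthogonal_less[of m k y]
  by (cases m k rule: linorder_cases) (auto simp: sqnorm_def mult.commute)

text \<open>The bound \<open>k\<close> is kept apart from \<open>n\<close> for the induction, which
  peels the leading term of \<open>r\<close> off with \<open>ortho_poly y k\<close>.\<close>

lemma L_ortho_poly_mult_less:
  assumes "k \<le> n" "\<And>i. i \<ge> k \<Longrightarrow> coeff r i = 0"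
  shows "L y (ortho_poly y n * r) = 0"
  using assms
proof (induction k arbitrary: r)
  case 0
  then have "r = 0" by (intro poly_eqI) auto
  then show ?case by (simp add: L_0)
next
  case (Suc k)
  define s where "s = r - smult (coeff r k) (ortho_poly y k)"
  have "coeff s i = 0" if "i \<ge> k" for i
    using that Suc.prems(2)[of i] by (cases "i = k") (auto simp: s_def coeff_ortho_poly_gt)
  then have "L y (ortho_poly y n * s) = 0" using Suc by auto
  moreover have "L y (ortho_poly y n * r)
      = L y (ortho_poly y n * s) + coeff r k * L y (ortho_poly y n * ortho_poly y k)"
    by (simp add: s_def right_diff_distrib L_diff L_smult)
  ultimately show ?case using Suc.prems(1) orthogonal_less[of k n y] by simp
qed

lemma L_ortho_poly_mult:
  assumes "\<And>i. i > n \<Longrightarrow> coeff r i = 0"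
  shows "L y (ortho_poly y n * r) = coeff r n * sqnorm y n"
proof -
  define s where "s = r - smult (coeff r n) (ortho_poly y n)"
  have "coeff s i = 0" if "i \<ge> n" for i
    using that assms[of i] by (cases "i = n") (auto simp: s_def coeff_ortho_poly_gt)
  then have "L y (ortho_poly y n * s) = 0" by (intro L_ortho_poly_mult_less[of n]) auto
  moreover have "L y (ortho_poly y n * r) = L y (ortho_poly y n * s) + coeff r n * sqnorm y n"
    by (simp add: s_def right_diff_distrib L_diff L_smult sqnorm_def)
  ultimately show ?thesis by simp
qed

section \<open>Differentiation in the parameter: the Toda equations\<close>

lemma ortho_poly_differentiable:
  "\<exists>G. has_poly_derivative (\<lambda>t. ortho_poly t n) G y"
proof (induction n rule: less_induct)
  case (less n)
  \<comment> \<open>The recurrence coefficients behind P_n are quotients of moments of P_k with k <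
    n, with positive norms as denominators; so differentiability passes up by strong
    induction.\<close>
  have sqnorm_diff: "(\<lambda>t. sqnorm t k) differentiable (at y)" if k: "k < n" for k
  proof -
    obtain G where "has_poly_derivative (\<lambda>t. ortho_poly t k) G y" using less.IH[OF k] by blast
    then have "has_poly_derivative (\<lambda>t. ortho_poly t k * ortho_poly t k)
        (G * ortho_poly y k + ortho_poly y k * G) y" (is "has_poly_derivative ?F ?G y")
      by (intro has_poly_derivative_mult)
    then have "((\<lambda>t. L t (?F t)) has_real_derivative L y ?G - L y (pCons 0 (?F y))) (at y)"
      by (rule L_poly_deriv[where m = "2 * k"])
        (simp add: degree_mult_le degree_ortho_poly coeff_eq_0 le_less_trans[OF degree_mult_le])
    then show ?thesis unfolding sqnorm_def
      using real_differentiable_def by blast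
  qed
  have mom_diff: "(\<lambda>t. L t (pCons 0 (ortho_poly t k * ortho_poly t k))) differentiable (at y)"
    if k: "k < n" for k
  proof -
    obtain G where "has_poly_derivative (\<lambda>t. ortho_poly t k) G y" using less.IH[OF k] by blast
    then have "has_poly_derivative (\<lambda>t. pCons 0 (ortho_poly t k * ortho_poly t k))
        (pCons 0 (G * ortho_poly y k + ortho_poly y k * G)) y" (is "has_poly_derivative ?F ?G y")
      by (intro has_poly_derivative_pCons_0 has_poly_derivative_mult)
    then have "((\<lambda>t. L t (?F t)) has_real_derivative L y ?G - L y (pCons 0 (?F y))) (at y)"
      by (rule L_poly_deriv[where m = "Suc (2 * k)"])
        (auto simp: coeff_pCons degree_ortho_poly coeff_eq_0 le_less_trans[OF degree_mult_le]
          split: nat.split)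
    then show ?thesis
      using real_differentiable_def by blast
  qed
  show ?case
  proof (cases n)
    case 0
    then show ?thesis using has_poly_derivative_const[of 1 y] by auto
  next
    case (Suc k)
    have nz: "sqnorm y i \<noteq> 0" for i using sqnorm_pos[of y i] by simp
    have "(\<lambda>t. rec_a t k) differentiable (at y)"
      unfolding rec_a_def using sqnorm_diff mom_diff nz Suc by (intro differentiable_divide) auto
    then obtain a' where a': "((\<lambda>t. rec_a t k) has_real_derivative a') (at y)"
      using real_differentiable_def by blast
    have "(\<lambda>t. rec_b t k) differentiable (at y)"
    proof (cases "k = 0")
      case False
      then show ?thesis unfolding rec_b_def
        using sqnorm_diff nz Suc by (auto intro!: differentiable_divide)
    qed (simp add: rec_b_def)
    then obtain b' where b': "((\<lambda>t. rec_b t k) has_real_derivative b') (at y)"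
      using real_differentiable_def by blast
    obtain G where G: "has_poly_derivative (\<lambda>t. ortho_poly t k) G y" using less Suc by blast
    obtain G' where G': "has_poly_derivative (\<lambda>t. ortho_poly t (k - 1)) G' y"
      using less.IH[of "k - 1"] Suc by (metis diff_le_self less_Suc_eq_le)
    show ?thesis unfolding Suc ortho_poly_rec
      using has_poly_derivative_diff[OF has_poly_derivative_diff[OF has_poly_derivative_pCons_0[OF G]
        has_poly_derivative_smult[OF G a']] has_poly_derivative_smult[OF G' b']] by blast
  qed
qed

text \<open>P_n is monic, so its leading coefficient is constant in the parameter; hence its
  derivative has degree below n and is orthogonal to P_n.\<close>

lemma has_poly_derivative_ortho_polyE:
  obtains G where "has_poly_derivative (\<lambda>t. ortho_poly t n) G y" "\<And>i. i \<ge> n \<Longrightarrow> coeff G i = 0"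
proof -
  obtain G where G: "has_poly_derivative (\<lambda>t. ortho_poly t n) G y"
    using ortho_poly_differentiable by blast
  have "coeff G i = 0" if "i \<ge> n" for i
  proof -
    have "(\<lambda>t. coeff (ortho_poly t n) i) = (\<lambda>t. if i = n then 1 else 0)"
      using that by (auto simp: coeff_ortho_poly_gt)
    then have "((\<lambda>t. if i = n then 1 else 0) has_real_derivative coeff G i) (at y)"
      using G unfolding has_poly_derivative_def by metis
    then show ?thesis using DERIV_const DERIV_unique by blast
  qed
  with G show ?thesis using that by blast
qed

text \<open>The terms containing the derivative of P_n vanish by orthogonality; only the derivative
  of the functional, -L(x P_n^2), survives.\<close>

lemma sqnorm_deriv: "((\<lambda>t. sqnorm t n) has_real_derivative - rec_a y n * sqnorm y n) (at y)"
proof -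
  obtain G where G: "has_poly_derivative (\<lambda>t. ortho_poly t n) G y"
    and deg: "\<And>i. i \<ge> n \<Longrightarrow> coeff G i = 0"
    by (rule has_poly_derivative_ortho_polyE[of n y]) blast
  have "L y (ortho_poly y n * G) = 0"
    using L_ortho_poly_mult_less deg by blast
  moreover have "((\<lambda>t. L t (ortho_poly t n * ortho_poly t n)) has_real_derivative
      L y (G * ortho_poly y n + ortho_poly y n * G)
      - L y (pCons 0 (ortho_poly y n * ortho_poly y n))) (at y)"
    by (rule L_poly_deriv[where m = "2 * n", OF has_poly_derivative_mult[OF G G]])
      (simp add: degree_ortho_poly coeff_eq_0 le_less_trans[OF degree_mult_le])
  moreover have "L y (pCons 0 (ortho_poly y n * ortho_poly y n)) = rec_a y n * sqnorm y n"
    using sqnorm_pos[of y n] by (simp add: rec_a_def)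
  ultimately show ?thesis
    unfolding sqnorm_def[symmetric] L_add mult.commute[of G] by simp
qed

text \<open>\<open>sub_p y n\<close> and \<open>sub_q y n\<close> are the coefficients of x^(n-1)
  and x^(n-2) in P_n. The recursions give 0 where no such coefficient exists.\<close>

primrec sub_p :: "real \<Rightarrow> nat \<Rightarrow> real" where
  "sub_p y 0 = 0"
| "sub_p y (Suc n) = sub_p y n - rec_a y n"

primrec sub_q :: "real \<Rightarrow> nat \<Rightarrow> real" where
  "sub_q y 0 = 0"
| "sub_q y (Suc n) = sub_q y n - rec_a y n * sub_p y n - rec_b y n"

lemma coeff_ortho_poly_sub_p: "coeff (ortho_poly y (Suc n)) n = sub_p y (Suc n)"
proof (induction n)
  case 0
  show ?case unfolding ortho_poly_rec by (simp add: rec_b_def)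
next
  case (Suc n)
  show ?case unfolding ortho_poly_rec[of y "Suc n"]
    using Suc by (simp add: coeff_ortho_poly_gt del: ortho_poly.simps)
qed

lemma coeff_ortho_poly_sub_q: "coeff (ortho_poly y (Suc (Suc n))) n = sub_q y (Suc (Suc n))"
proof (induction n)
  case 0
  show ?case unfolding ortho_poly_rec[of y "Suc 0"]
    using coeff_ortho_poly_sub_p[of y 0]
    by (simp add: rec_b_def[of y 0] del: ortho_poly.simps)
next
  case (Suc n)
  show ?case unfolding ortho_poly_rec[of y "Suc (Suc n)"]
    using coeff_ortho_poly_sub_p[of y "Suc n"] Suc
    by (simp del: ortho_poly.simps)
qed

text \<open>Differentiate L(P_n P_(n-1)) = 0. The derivative of P_n has coefficient p_n' at x^(n-1),
  which contributes p_n' h_(n-1); the derivative of P_(n-1) is orthogonal to P_n; the functional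
  contributes -L(x P_n P_(n-1)) = -b_n h_(n-1).\<close>

lemma sub_p_deriv: "((\<lambda>t. sub_p t n) has_real_derivative rec_b y n) (at y)"
proof (cases n)
  case 0
  then show ?thesis by (simp add: rec_b_def)
next
  case (Suc k)
  let ?P = "ortho_poly"
  obtain G where G: "has_poly_derivative (\<lambda>t. ?P t n) G y"
    and deg: "\<And>i. i \<ge> n \<Longrightarrow> coeff G i = 0"
    by (rule has_poly_derivative_ortho_polyE[of n y]) blast
  obtain H where H: "has_poly_derivative (\<lambda>t. ?P t k) H y"
    and degH: "\<And>i. i \<ge> k \<Longrightarrow> coeff H i = 0"
    by (rule has_poly_derivative_ortho_polyE[of k y]) blast
  have "((\<lambda>t. L t (?P t n * ?P t k)) has_real_derivative
      L y (G * ?P y k + ?P y n * H) - L y (pCons 0 (?P y n * ?P y k))) (at y)"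
    by (rule L_poly_deriv[where m = "n + k", OF has_poly_derivative_mult[OF G H]])
      (simp add: degree_ortho_poly coeff_eq_0 le_less_trans[OF degree_mult_le])
  then have "((\<lambda>t. 0) has_real_derivative
      L y (G * ?P y k + ?P y n * H) - L y (pCons 0 (?P y n * ?P y k))) (at y)"
    using Suc by (simp add: L_ortho_poly_ortho_poly del: ortho_poly.simps)
  then have "L y (G * ?P y k + ?P y n * H) = L y (pCons 0 (?P y n * ?P y k))"
    using DERIV_const DERIV_unique by fastforce
  moreover have "L y (G * ?P y k) = coeff G k * sqnorm y k"
    unfolding mult.commute[of G] using Suc deg by (intro L_ortho_poly_mult) auto
  moreover have "L y (?P y n * H) = 0"
    by (rule L_ortho_poly_mult_less[of k]) (use Suc degH in auto)
  moreover have "L y (pCons 0 (?P y n * ?P y k)) = rec_b y n * sqnorm y k"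
    unfolding L_pCons_mult_ortho_poly using Suc by (simp add: L_ortho_poly_ortho_poly del: ortho_poly.simps)
  ultimately have "coeff G k = rec_b y n"
    using sqnorm_pos[of y k] by (simp add: L_add)
  then show ?thesis
    using G unfolding has_poly_derivative_def Suc coeff_ortho_poly_sub_p[symmetric] by metis
qed

lemma rec_b_deriv:
  "((\<lambda>t. rec_b t n) has_real_derivative rec_b y n * (rec_a y (n - 1) - rec_a y n)) (at y)"
proof (cases n)
  case 0
  then show ?thesis by (simp add: rec_b_def)
next
  case (Suc k)
  have "((\<lambda>t. sqnorm t (Suc k) / sqnorm t k) has_real_derivative
      (- rec_a y (Suc k) * sqnorm y (Suc k) * sqnorm y k
        - sqnorm y (Suc k) * (- rec_a y k * sqnorm y k)) / (sqnorm y k * sqnorm y k)) (at y)"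
    using sqnorm_pos[of y k] by (intro DERIV_divide sqnorm_deriv) auto
  moreover have "(- rec_a y (Suc k) * sqnorm y (Suc k) * sqnorm y k
        - sqnorm y (Suc k) * (- rec_a y k * sqnorm y k)) / (sqnorm y k * sqnorm y k)
      = rec_b y n * (rec_a y (n - 1) - rec_a y n)"
    using Suc sqnorm_pos[of y k] by (simp add: rec_b_def divide_simps algebra_simps)
  ultimately show ?thesis
    using Suc by (simp add: rec_b_def)
qed

section \<open>Difference equations from Pearson's equation\<close>

lemma string_A:
  "2 * real n + 1 + \<alpha> + 2 * sub_p y n - (2 * real n + 2 + \<alpha> + \<beta> + y) * rec_a y n
     + y * ((rec_a y n)\<^sup>2 + rec_b y n + rec_b y (Suc n)) = 0"
proof -
  let ?P = "ortho_poly y n" and ?Q = "ortho_poly y (Suc n)" and ?h = "sqnorm y n"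
  \<comment> \<open>In x(1 - x) P_n' the coefficient of x^(n+1) is -n; adding n P_(n+1) removes it
    without changing the pairing with P_n. The rest has degree at most n, so only its coefficient of
    x^n counts.\<close>
  define r where "r = [:0, 1, -1:] * pderiv ?P + smult (real n) ?Q"
  have cP: "coeff ?P (n - 1) = sub_p y n" if "n \<noteq> 0"
    using that by (cases n) (simp_all add: coeff_ortho_poly_sub_p[simplified] del: ortho_poly.simps)
  have r0: "coeff r i = 0" if "i > n" for i
    using that unfolding r_def coeff_add coeff_sigma_pderiv[OF gr_implies_not0[OF that, THEN neq0_conv[THEN iffD1]]]
    by (cases "i = Suc n") (auto simp: coeff_ortho_poly_gt simp del: ortho_poly.simps)
  have rn: "coeff r n = real n + sub_p y n - real n * rec_a y n"
  proof (cases "n = 0")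
    case False
    then show ?thesis
      unfolding r_def coeff_add coeff_sigma_pderiv[OF False[THEN neq0_conv[THEN iffD1]]]
      using cP[OF False] by (simp add: coeff_ortho_poly_sub_p algebra_simps del: ortho_poly.simps)
  qed (simp add: r_def)
  have "[:0, 1, -1:] * pderiv ?P = r - smult (real n) ?Q" by (simp add: r_def)
  then have d: "L y (?P * ([:0, 1, -1:] * pderiv ?P)) = coeff r n * ?h"
    using L_ortho_poly_mult[OF r0, where y = y]
    by (simp only: right_diff_distrib L_diff mult_smult_right L_smult L_ortho_poly_ortho_poly if_False
        n_not_Suc_n mult_zero_right diff_0_right)
  have x1: "L y (pCons 0 (?P * ?P)) = rec_a y n * ?h"
    using sqnorm_pos[of y n] by (simp add: rec_a_def)
  \<comment> \<open>The second moment of P_n^2 is the squared norm of x P_n, expanded by the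
    three-term recurrence.\<close>
  have "pCons 0 (pCons 0 (?P * ?P)) = pCons 0 ?P * pCons 0 ?P" by simp
  also have "L y \<dots> = sqnorm y (Suc n) + (rec_a y n)\<^sup>2 * ?h + rec_b y n * rec_b y n * sqnorm y (n - 1)"
    unfolding pCons_ortho_poly
    by (simp only: distrib_left distrib_right mult_smult_left mult_smult_right L_add L_smult
        L_ortho_poly_ortho_poly)
      (cases n; simp add: power2_eq_square rec_b_def[of y 0])
  also have "\<dots> = (rec_b y (Suc n) + (rec_a y n)\<^sup>2 + rec_b y n) * ?h"
    by (cases n) (simp_all add: sqnorm_Suc rec_b_def[of y 0] algebra_simps)
  finally have x2: "L y (pCons 0 (pCons 0 (?P * ?P))) = (rec_b y (Suc n) + (rec_a y n)\<^sup>2 + rec_b y n) * ?h" .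
  have "pderiv ([:0, 1, -1:] * (?P * ?P)) = smult 2 (?P * ([:0, 1, -1:] * pderiv ?P)) + [:1, -2, 0:] * (?P * ?P)"
  proof -
    have "pderiv [:0, 1, -1 :: real:] = [:1, -2, 0:]" by (simp add: pderiv_pCons)
    then show ?thesis
      unfolding pderiv_mult by (simp only: algebra_simps mult_2 smult_add_left smult_1_left one_add_one[symmetric])
  qed
  \<comment> \<open>Pearson's equation tested on P_n^2; every term is a multiple of h_n.\<close>
  then have "0 = L y (smult 2 (?P * ([:0, 1, -1:] * pderiv ?P)) + [:1, -2, 0:] * (?P * ?P)
      + [:\<alpha>, - (\<alpha> + \<beta> + y), y:] * (?P * ?P))"
    using pearson[of y "?P * ?P"] by simp
  also have "\<dots> = ?h * (2 * coeff r n + 1 - 2 * rec_a y n + \<alpha> - (\<alpha> + \<beta> + y) * rec_a y n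
      + y * (rec_b y (Suc n) + (rec_a y n)\<^sup>2 + rec_b y n))"
    unfolding quadratic_mult[of _ _ _ "?P * ?P"] L_add L_smult d x1 x2 sqnorm_def[symmetric] by (simp add: algebra_simps)
  finally have "2 * coeff r n + 1 - 2 * rec_a y n + \<alpha> - (\<alpha> + \<beta> + y) * rec_a y n
      + y * (rec_b y (Suc n) + (rec_a y n)\<^sup>2 + rec_b y n) = 0"
    using sqnorm_pos[of y n] by simp
  then show ?thesis
    by (simp add: rn algebra_simps)
qed

text \<open>Pearson's equation tested on P_n P_(n-1). The coefficient of x^(n-2) enters through
  \<open>sub_q\<close>; taking differences in n eliminates it later, in
  \<open>X_fun_step\<close>.\<close>

lemma string_B:
  "- sub_p y n + 2 * sub_q y n - (sub_p y n)\<^sup>2 - (2 * real n + 1 + \<alpha> + \<beta> + y) * rec_b y n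
     + y * rec_b y n * (rec_a y n + rec_a y (n - 1)) = 0"
proof (cases n)
  case 0
  then show ?thesis by (simp add: rec_b_def)
next
  case (Suc m)
  let ?S = "ortho_poly y (Suc m)" and ?T = "ortho_poly y m" and ?U = "ortho_poly y (Suc (Suc m))"
  let ?p = "sub_p y (Suc m)" and ?q = "sub_q y (Suc m)"
  let ?a = "rec_a y (Suc m)" and ?b = "rec_b y (Suc m)"
  have pU: "coeff ?U (Suc m) = ?p - ?a" using coeff_ortho_poly_sub_p[of y "Suc m"] by simp
  have qU: "coeff ?U m = ?q - ?a * ?p - ?b" using coeff_ortho_poly_sub_q[of y "m"] by simp
  have pS: "coeff ?S m = ?p" by (rule coeff_ortho_poly_sub_p)
  have qS: "coeff ?S (m - 1) * (real m - 1) = ?q * (real m - 1)" if "m > 0"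
    using that coeff_ortho_poly_sub_q[of y "m - 1"] by (cases m) simp_all
  have q1: "?q = 0" if "m = 0" using that by (simp add: rec_b_def)
  \<comment> \<open>\<open>c\<close> is the coefficient of x^(m+1) that remains once (m + 1) P_(m+2)
    has cancelled the top term of x(1 - x) P_(m+1)'. Subtracting c P_(m+1) leaves degree at most m,
    and both P_(m+1) and P_(m+2) are orthogonal to P_m.\<close>
  define c where "c = real m + 1 + ?p - (real m + 1) * ?a"
  define r where "r = [:0, 1, -1:] * pderiv ?S + smult (real m + 1) ?U - smult c ?S"
  have r0: "coeff r i = 0" if "i > m" for i
  proof -
    have "coeff ([:0, 1, -1:] * pderiv ?S) i = real i * coeff ?S i - (real i - 1) * coeff ?S (i - 1)"
      using that by (intro coeff_sigma_pderiv) auto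
    moreover have "i = Suc m \<or> i = Suc (Suc m) \<or> i > Suc (Suc m)" using that by auto
    ultimately show ?thesis unfolding r_def coeff_add coeff_diff coeff_smult
      by (elim disjE)
        (simp_all add: pU pS c_def coeff_ortho_poly_gt algebra_simps del: ortho_poly.simps)
  qed
  have rm: "coeff r m = real m * ?p - (real m - 1) * ?q + (real m + 1) * (?q - ?a * ?p - ?b) - c * ?p"
  proof (cases "m = 0")
    case True
    then show ?thesis
      unfolding r_def coeff_add coeff_diff coeff_smult qU pS using q1 by simp
  next
    case False
    have "coeff ([:0, 1, -1:] * pderiv ?S) m = real m * coeff ?S m - (real m - 1) * coeff ?S (m - 1)"
      using False by (intro coeff_sigma_pderiv) auto
    then show ?thesis
      unfolding r_def coeff_add coeff_diff coeff_smult qU pS using qS False by (simp add: algebra_simps)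
  qed
  have "[:0, 1, -1:] * pderiv ?S = r - smult (real m + 1) ?U + smult c ?S" by (simp add: r_def)
  then have d1: "L y (?T * ([:0, 1, -1:] * pderiv ?S)) = coeff r m * sqnorm y m"
    using L_ortho_poly_mult[OF r0, where y = y]
    by (simp only: distrib_left right_diff_distrib L_diff L_add mult_smult_right L_smult
        L_ortho_poly_ortho_poly) simp
  \<comment> \<open>x(1 - x) P_m' has degree at most m + 1 with coefficient -m there, and only this
    coefficient survives against P_(m+1).\<close>
  have "L y (?S * ([:0, 1, -1:] * pderiv ?T)) = coeff ([:0, 1, -1:] * pderiv ?T) (Suc m) * sqnorm y (Suc m)"
  proof (rule L_ortho_poly_mult)
    fix i assume "i > Suc m"
    then show "coeff ([:0, 1, -1:] * pderiv ?T) i = 0"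
      by (subst coeff_sigma_pderiv) (auto simp: coeff_ortho_poly_gt)
  qed
  also have "coeff ([:0, 1, -1:] * pderiv ?T) (Suc m) = - real m"
    by (subst coeff_sigma_pderiv) (auto simp: coeff_ortho_poly_gt)
  finally have d2: "L y (?S * ([:0, 1, -1:] * pderiv ?T)) = - real m * sqnorm y (Suc m)" .
  have x0: "L y (?S * ?T) = 0" by (simp add: L_ortho_poly_ortho_poly del: ortho_poly.simps)
  have x1: "L y (pCons 0 (?S * ?T)) = sqnorm y (Suc m)"
    unfolding L_pCons_mult_ortho_poly
    by (simp add: L_ortho_poly_ortho_poly sqnorm_Suc del: ortho_poly.simps)
  have "pCons 0 (pCons 0 (?S * ?T)) = pCons 0 ?S * pCons 0 ?T" by simp
  also have "L y \<dots> = sqnorm y (Suc m) * (?a + rec_a y m)"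
    unfolding pCons_ortho_poly
    by (cases m) (simp_all add: algebra_simps L_add L_smult L_ortho_poly_ortho_poly sqnorm_Suc
        rec_b_def[of y 0] del: ortho_poly.simps)
  finally have x2: "L y (pCons 0 (pCons 0 (?S * ?T))) = sqnorm y (Suc m) * (?a + rec_a y m)" .
  have "pderiv ([:0, 1, -1:] * (?S * ?T)) = ?T * ([:0, 1, -1:] * pderiv ?S)
      + ?S * ([:0, 1, -1:] * pderiv ?T) + [:1, -2, 0:] * (?S * ?T)"
  proof -
    have "pderiv [:0, 1, -1 :: real:] = [:1, -2, 0:]" by (simp add: pderiv_pCons)
    then show ?thesis
      unfolding pderiv_mult by (simp only: algebra_simps)
  qed
  then have "0 = L y (?T * ([:0, 1, -1:] * pderiv ?S)
      + ?S * ([:0, 1, -1:] * pderiv ?T) + [:1, -2, 0:] * (?S * ?T)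
      + [:\<alpha>, - (\<alpha> + \<beta> + y), y:] * (?S * ?T))"
    using pearson[of y "?S * ?T"] by simp
  also have "\<dots> = sqnorm y m * (coeff r m - real m * ?b - 2 * ?b - (\<alpha> + \<beta> + y) * ?b
      + y * ?b * (?a + rec_a y m))"
    unfolding quadratic_mult[of _ _ _ "?S * ?T"] L_add L_smult d1 d2 x0 x1 x2 sqnorm_Suc by (simp add: algebra_simps)
  finally have "coeff r m - real m * ?b - 2 * ?b - (\<alpha> + \<beta> + y) * ?b + y * ?b * (?a + rec_a y m) = 0"
    using sqnorm_pos[of y m] by simp
  then show ?thesis
    unfolding rm c_def Suc
    by (simp add: algebra_simps power2_eq_square del: sub_p.simps sub_q.simps)
qed

subsection \<open>First integrals of the difference equations\<close>

text \<open>Chosen so that \<open>string_A\<close> factors, as \<open>phi_add_phi_Suc\<close>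
  shows.\<close>

definition X_fun :: "real \<Rightarrow> nat \<Rightarrow> real" where
  "X_fun y n = 2 * real n + 1 + \<alpha> + \<beta> - y * rec_a y n"

definition phi :: "real \<Rightarrow> nat \<Rightarrow> real" where
  "phi y n = sub_p y n + y * rec_b y n"

lemma phi_add_phi_Suc: "phi y n + phi y (Suc n) - \<beta> = X_fun y n * (rec_a y n - 1)"
  using string_A[of n y] by (simp add: phi_def X_fun_def algebra_simps power2_eq_square)

text \<open>Subtract \<open>string_B\<close> at n from \<open>string_B\<close> at n + 1: the
  recursion for \<open>sub_q\<close> replaces q_(n+1) - q_n by -a_n p_n - b_n, and the remainder
  regroups.\<close>

lemma X_fun_step:
  "rec_b y (Suc n) * X_fun y (Suc n) - rec_b y n * X_fun y (n - 1)
     = (rec_a y n - 1) * (phi y (Suc n) - phi y n)"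
  using string_B[of y n] string_B[of y "Suc n"]
  by (cases n) (simp_all add: phi_def X_fun_def algebra_simps power2_eq_square rec_b_def[of y 0])

lemma linear_identity:
  "(2 * real n + \<alpha> + \<beta>) * sub_p y n + real n * (real n + \<alpha>)
     = y * rec_b y n * (X_fun y n + X_fun y (n - 1) + y - (2 * real n + \<alpha> + \<beta>))"
proof (induction n)
  case 0
  show ?case by (simp add: rec_b_def)
next
  case (Suc n)
  \<comment> \<open>In the claim X_(n+1) occurs only in the product b_(n+1) X_(n+1), which
    \<open>X_fun_step\<close> expresses by smaller indices; with \<open>string_A\<close> and the
    induction hypothesis a polynomial identity remains.\<close>
  have "rec_b y (Suc n) * X_fun y (Suc n) = rec_b y n * X_fun y (n - 1)
     + (rec_a y n - 1) * (phi y (Suc n) - phi y n)"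
    using X_fun_step[of y n] by simp
  moreover have "X_fun y n = 2 * real n + 1 + \<alpha> + \<beta> - y * rec_a y n" by (rule X_fun_def)
  ultimately show ?case
    using Suc string_A[of n y] unfolding phi_def
    apply (simp add: of_nat_Suc)
    by Groebner_Basis.algebra
qed

text \<open>Multiply \<open>X_fun_step\<close> by X_n and replace X_n (a_n - 1) by
  \<open>phi_add_phi_Suc\<close>: the right side becomes (phi_(n+1) + phi_n - \<beta>)(phi_(n+1) -
  phi_n), the increment of phi (phi - \<beta>). So the identity telescopes from 0 at n = 0.\<close>

lemma quadratic_identity:
  "rec_b y n * X_fun y n * X_fun y (n - 1) = phi y n * (phi y n - \<beta>)"
proof (induction n)
  case 0
  show ?case by (simp add: rec_b_def phi_def)
next
  case (Suc n)
  then show ?case using X_fun_step[of y n] phi_add_phi_Suc[of y n]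
    apply simp
    by Groebner_Basis.algebra
qed

text \<open>The left side is the derivative of \<open>phi y n\<close>: one b_n is the derivative of
  p_n, the other comes from the product rule for y b_n.\<close>

lemma rec_b_deriv_X:
  "2 * rec_b y n + y * (rec_b y n * (rec_a y (n - 1) - rec_a y n))
     = rec_b y n * (X_fun y n - X_fun y (n - 1))"
  by (cases n) (simp_all add: X_fun_def rec_b_def[of y 0] algebra_simps)

text \<open>The sum X_n + X_(n-1) comes from \<open>linear_identity\<close>, the product from
  \<open>quadratic_identity\<close>; each carries a factor b_n, so no division takes place.\<close>

lemma sigma_form:
  fixes y f f' f'' :: real and n :: nat
  defines "f \<equiv> real n * (real n + \<alpha> + \<beta>) + y * sub_p y n"
    and "f' \<equiv> phi y n" and "f'' \<equiv> rec_b y n * (X_fun y n - X_fun y (n - 1))"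
  shows "y\<^sup>2 * f''\<^sup>2 = ((2 * real n + \<alpha> + \<beta> - y) * f' + f - real n * \<beta>)\<^sup>2
     - 4 * (y * f' - f + real n * (real n + \<alpha> + \<beta>)) * f' * (f' - \<beta>)"
proof -
  have 1: "y * (rec_b y n * X_fun y n + rec_b y n * X_fun y (n - 1))
      = (2 * real n + \<alpha> + \<beta> - y) * f' + f - real n * \<beta>"
    using linear_identity[of n y] unfolding f_def f'_def phi_def by (simp add: algebra_simps)
  \<comment> \<open>This expresses b_n by f and f', as f' = p_n + y b_n while f contains y
    p_n.\<close>
  have 2: "y * f' - f + real n * (real n + \<alpha> + \<beta>) = y\<^sup>2 * rec_b y n"
    unfolding f_def f'_def phi_def by (simp add: algebra_simps power2_eq_square)
  have "y\<^sup>2 * f''\<^sup>2 = (y * (rec_b y n * X_fun y n + rec_b y n * X_fun y (n - 1)))\<^sup>2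
      - 4 * (y\<^sup>2 * rec_b y n) * (rec_b y n * X_fun y n * X_fun y (n - 1))"
    unfolding f''_def by Groebner_Basis.algebra
  then show ?thesis
    unfolding 1 2[symmetric] quadratic_identity f'_def by (simp add: algebra_simps)
qed

end

section \<open>The exponentially deformed Jacobi weight\<close>

text \<open>Supplies the quadratic remainder for differentiating e^(-y u) under the integral
  sign.\<close>

lemma exp_quadratic_bound: "\<bar>exp x - 1 - x\<bar> \<le> exp \<bar>x\<bar> * x\<^sup>2" for x :: real
proof -
  obtain t where t: "\<bar>t\<bar> \<le> \<bar>x\<bar>" "exp x = (\<Sum>m<2. x ^ m / fact m) + exp t / fact 2 * x ^ 2"
    using Maclaurin_exp_le[of x 2] by blast
  then have eq: "exp x - 1 - x = exp t / 2 * x\<^sup>2" by (simp add: numeral_2_eq_2)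
  have "\<bar>exp x - 1 - x\<bar> = exp t / 2 * x\<^sup>2" unfolding eq by (simp add: abs_mult)
  also have "\<dots> \<le> exp \<bar>x\<bar> * x\<^sup>2"
  proof (rule mult_right_mono)
    have "exp t \<le> exp \<bar>x\<bar>" using t(1) by simp
    then show "exp t / 2 \<le> exp \<bar>x\<bar>" by (smt (verit) exp_ge_zero field_sum_of_halves)
  qed simp
  finally show ?thesis .
qed

locale jacobi_weight =
  fixes a b \<alpha> \<beta> :: real
  assumes ab: "a < b" and \<alpha>: "\<alpha> > -1" and \<beta>: "\<beta> > -1"
begin

definition unit :: "real \<Rightarrow> real" where
  "unit z = (z - a) / (b - a)"

definition base :: "real \<Rightarrow> real" where
  "base z = indicator {a..b} z * ((z - a) powr \<alpha> * (b - z) powr \<beta>)"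

text \<open>The integral runs over z in [a,b] with the weight not rescaled: it is (b - a)^(\<alpha>
  + \<beta> + 1) times the moment on [0,1], a constant factor to which the axioms of
  \<open>moment_functional\<close> are insensitive.\<close>

definition moment :: "real \<Rightarrow> real poly \<Rightarrow> real" where
  "moment y p = (\<integral>z. base z * (poly p (unit z) * exp (- y * unit z)) \<partial>lborel)"

lemma base_nonneg: "base z \<ge> 0"
  by (simp add: base_def)

lemma base_measurable [measurable]: "base \<in> borel_measurable borel"
  unfolding base_def by measurable

text \<open>Affine pull-back of the Beta density, integrable because both exponents exceed
  -1.\<close>

lemma base_integrable: "integrable lborel base"
proof -
  define f where "f t = indicator {0..1} t *\<^sub>R (t powr \<alpha> * (1 - t) powr \<beta>)" for t :: real
  have "integrable lborel f"
    using integrable_Beta[of "\<alpha> + 1" "\<beta> + 1"] \<alpha> \<beta> unfolding set_integrable_def f_def by simp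
  then have "integrable lborel (\<lambda>z. f (- a / (b - a) + 1 / (b - a) * z))"
    using ab by (intro lborel_integrable_real_affine) auto
  also have "(\<lambda>z. f (- a / (b - a) + 1 / (b - a) * z))
      = (\<lambda>z. base z / ((b - a) powr \<alpha> * (b - a) powr \<beta>))"
  proof
    fix z
    have u: "- a / (b - a) + 1 / (b - a) * z = (z - a) / (b - a)"
      and u': "1 - (z - a) / (b - a) = (b - z) / (b - a)"
      using ab by (simp_all add: diff_divide_distrib) (simp add: divide_simps)
    show "f (- a / (b - a) + 1 / (b - a) * z) = base z / ((b - a) powr \<alpha> * (b - a) powr \<beta>)"
    proof (cases "z \<in> {a..b}")
      case True
      then show ?thesis unfolding u f_def u' using ab
        by (simp add: base_def indicator_def powr_divide divide_simps)
    next
      case False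
      then have "(z - a) / (b - a) \<notin> {0..1}" using ab by (simp add: divide_simps)
      then show ?thesis unfolding u f_def using False by (simp add: base_def)
    qed
  qed
  finally have "integrable lborel (\<lambda>z. (b - a) powr \<alpha> * (b - a) powr \<beta>
      * (base z / ((b - a) powr \<alpha> * (b - a) powr \<beta>)))"
    by (rule integrable_mult_right)
  then show ?thesis using ab by simp
qed

lemma base_mult_integrable:
  assumes cont: "continuous_on UNIV g"
  shows "integrable lborel (\<lambda>z. base z * g z)"
proof -
  have [measurable]: "g \<in> borel_measurable borel"
    using cont by (simp add: borel_measurable_continuous_onI)
  have "compact (g ` {a..b})"
    using continuous_on_subset[OF cont] by (intro compact_continuous_image) auto
  then obtain C where C: "\<And>z. z \<in> {a..b} \<Longrightarrow> norm (g z) \<le> C"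
    using compact_imp_bounded bounded_iff by (metis imageI)
  show ?thesis
  proof (rule Bochner_Integration.integrable_bound)
    show "integrable lborel (\<lambda>z. C * base z)" using base_integrable by simp
    show "AE z in lborel. norm (base z * g z) \<le> norm (C * base z)"
    proof (rule AE_I2)
      fix z
      show "norm (base z * g z) \<le> norm (C * base z)"
      proof (cases "z \<in> {a..b}")
        case True
        have "norm (base z * g z) = base z * \<bar>g z\<bar>" by (simp add: abs_mult base_nonneg)
        also have "\<dots> \<le> base z * C"
          using C[OF True] base_nonneg by (intro mult_left_mono) auto
        also have "\<dots> \<le> norm (C * base z)" by (simp add: mult.commute)
        finally show ?thesis .
      qed (simp add: base_def)
    qed
  qed simp
qed

lemma continuous_on_unit [continuous_intros]: "continuous_on A unit"
  using ab unfolding unit_def by (intro continuous_intros) auto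

section \<open>Verification of the axioms of a moment functional\<close>

lemma moment_integrable:
  "integrable lborel (\<lambda>z. base z * (poly p (unit z) * exp (- y * unit z)))"
  by (intro base_mult_integrable continuous_intros)

lemma unit_range: "z \<in> {a..b} \<Longrightarrow> 0 \<le> unit z \<and> unit z \<le> 1"
  using ab by (auto simp: unit_def field_simps)

lemma moment_add: "moment y (p + q) = moment y p + moment y q"
  unfolding moment_def Bochner_Integration.integral_add[OF moment_integrable moment_integrable, symmetric]
  by (simp add: algebra_simps)

lemma moment_smult: "moment y (smult c p) = c * moment y p"
  unfolding moment_def integral_mult_right_zero[symmetric] by (simp add: algebra_simps)

text \<open>The integrand is nonnegative, and weight and exponential are positive on (a,b). A zero
  integral would make p vanish almost everywhere there, but p has finitely many roots.\<close>

lemma moment_pos: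
  assumes "p \<noteq> 0"
  shows "moment y (p * p) > 0"
proof -
  let ?f = "\<lambda>z. base z * (poly (p * p) (unit z) * exp (- y * unit z))"
  have nonneg: "?f z \<ge> 0" for z by (simp add: base_nonneg)
  have "moment y (p * p) \<noteq> 0"
  proof
    assume "moment y (p * p) = 0"
    moreover have "(\<integral>z. ?f z \<partial>lborel) = 0 \<longleftrightarrow> (AE z in lborel. ?f z = 0)"
      using nonneg by (intro integral_nonneg_eq_0_iff_AE moment_integrable) auto
    ultimately have "AE z in lborel. ?f z = 0"
      unfolding moment_def by blast
    moreover have inj: "inj unit" using ab by (auto simp: inj_def unit_def)
    have fin: "finite {z. poly p (unit z) = 0}"
      using finite_vimageI[OF poly_roots_finite[OF assms] inj] by (simp add: vimage_def)
    then have "AE z in lborel. z \<notin> {z. poly p (unit z) = 0}"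
      by (intro AE_not_in finite_imp_null_set_lborel)
    ultimately have "AE z in lborel. z \<notin> {a<..<b}"
      by eventually_elim (auto simp: base_def)
    then have "emeasure lborel {a<..<b} = 0"
      by (subst (asm) AE_iff_measurable[where N = "{a<..<b}"]) auto
    then show False using ab by simp
  qed
  moreover have "moment y (p * p) \<ge> 0"
    unfolding moment_def by (intro integral_nonneg_AE AE_I2 nonneg)
  ultimately show ?thesis by simp
qed

lemma moment_deriv:
  "((\<lambda>t. moment t p) has_real_derivative - moment y (pCons 0 p)) (at y)"
proof -
  let ?g = "\<lambda>z. \<bar>poly p (unit z)\<bar> * exp (- y * unit z)"
  \<comment> \<open>For |h| < 1 and \<open>unit z\<close> in [0,1] the exponential in
    \<open>exp_quadratic_bound\<close> is at most e, whence the factor \<open>exp 1\<close>.\<close>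
  define C where "C = exp 1 * (\<integral>z. base z * ?g z \<partial>lborel)"
  have intg: "integrable lborel (\<lambda>z. base z * ?g z)"
    by (intro base_mult_integrable continuous_intros)
  have bound: "norm ((moment (y + h) p - moment y p) / h - - moment y (pCons 0 p)) \<le> C * \<bar>h\<bar>"
    if h: "h \<noteq> 0" "\<bar>h\<bar> < 1" for h
  proof -
    let ?r = "\<lambda>z. base z * (poly p (unit z) * exp (- (y + h) * unit z))
        - base z * (poly p (unit z) * exp (- y * unit z))
        + h * (base z * (poly (pCons 0 p) (unit z) * exp (- y * unit z)))"
    have int: "integrable lborel ?r"
      by (intro Bochner_Integration.integrable_add Bochner_Integration.integrable_diff
          integrable_mult_right moment_integrable)
    have "moment (y + h) p - moment y p + h * moment y (pCons 0 p) = (\<integral>z. ?r z \<partial>lborel)"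
      unfolding moment_def 
      by (simp only: Bochner_Integration.integral_add Bochner_Integration.integral_diff
          integral_mult_right_zero Bochner_Integration.integrable_diff integrable_mult_right
          moment_integrable)
    moreover have "norm (\<integral>z. ?r z \<partial>lborel) \<le> (\<integral>z. h\<^sup>2 * exp 1 * (base z * ?g z) \<partial>lborel)"
    proof (rule order_trans[OF integral_norm_bound integral_mono])
      show "integrable lborel (\<lambda>z. norm (?r z))" using int by (rule integrable_norm)
      show "integrable lborel (\<lambda>z. h\<^sup>2 * exp 1 * (base z * ?g z))"
        using intg by (rule integrable_mult_right)
      fix z
      show "norm (?r z) \<le> h\<^sup>2 * exp 1 * (base z * ?g z)"
      proof (cases "z \<in> {a..b}")
        case True
        then have u: "0 \<le> unit z" "unit z \<le> 1" using unit_range by auto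
        let ?x = "- h * unit z"
        have x: "\<bar>?x\<bar> \<le> \<bar>h\<bar>" using u by (simp add: abs_mult mult_left_le)
        have "?r z = base z * (poly p (unit z) * exp (- y * unit z)) * (exp ?x - 1 - ?x)"
        proof -
          have "exp (- (y + h) * unit z) = exp (- y * unit z) * exp ?x"
            unfolding exp_add[symmetric] by (simp add: algebra_simps)
          then show ?thesis by (simp add: algebra_simps)
        qed
        then have "norm (?r z) = base z * ?g z * \<bar>exp ?x - 1 - ?x\<bar>"
          by (simp add: abs_mult base_nonneg)
        also have "\<dots> \<le> base z * ?g z * (exp 1 * h\<^sup>2)"
        proof (rule mult_left_mono)
          have "\<bar>exp ?x - 1 - ?x\<bar> \<le> exp \<bar>?x\<bar> * ?x\<^sup>2" by (rule exp_quadratic_bound)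
          also have "\<dots> \<le> exp 1 * h\<^sup>2"
          proof (rule mult_mono)
            have "\<bar>?x\<bar> \<le> 1" using x h by linarith
            then show "exp \<bar>?x\<bar> \<le> exp 1" by (simp only: exp_le_cancel_iff)
            show "?x\<^sup>2 \<le> h\<^sup>2" using x by (simp only: abs_le_square_iff)
          qed simp_all
          finally show "\<bar>exp ?x - 1 - ?x\<bar> \<le> exp 1 * h\<^sup>2" .
        qed (simp add: base_nonneg)
        finally show ?thesis by (simp add: mult_ac)
      qed (simp add: base_def)
    qed
    ultimately have main: "\<bar>moment (y + h) p - moment y p + h * moment y (pCons 0 p)\<bar> \<le> h\<^sup>2 * C"
      by (simp add: C_def mult.assoc)
    have "(moment (y + h) p - moment y p) / h - - moment y (pCons 0 p)
        = (moment (y + h) p - moment y p + h * moment y (pCons 0 p)) / h"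
      using h by (simp add: field_simps)
    then have "norm ((moment (y + h) p - moment y p) / h - - moment y (pCons 0 p))
        = \<bar>moment (y + h) p - moment y p + h * moment y (pCons 0 p)\<bar> / \<bar>h\<bar>" by simp
    also have "\<dots> \<le> h\<^sup>2 * C / \<bar>h\<bar>" using main by (rule divide_right_mono) simp
    also have "\<dots> = C * \<bar>h\<bar>" using h by (simp add: power2_eq_square divide_simps)
    finally show ?thesis .
  qed
  have "((\<lambda>h. (moment (y + h) p - moment y p) / h - - moment y (pCons 0 p)) \<longlongrightarrow> 0) (at 0)"
  proof (rule Lim_null_comparison)
    show "\<forall>\<^sub>F h in at 0. norm ((moment (y + h) p - moment y p) / h - - moment y (pCons 0 p)) \<le> C * \<bar>h\<bar>"
      unfolding eventually_at using bound by (intro exI[of _ 1]) auto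
    show "((\<lambda>h. C * \<bar>h\<bar>) \<longlongrightarrow> 0) (at 0)" by (auto intro!: tendsto_eq_intros)
  qed
  then show ?thesis unfolding DERIV_def by (rule LIM_zero_cancel)
qed

lemma moment_pearson:
  "moment y (pderiv ([:0, 1, -1:] * p) + [:\<alpha>, - (\<alpha> + \<beta> + y), y:] * p) = 0"
proof -
  define r where "r = pderiv ([:0, 1, -1:] * p) + [:\<alpha>, - (\<alpha> + \<beta> + y), y:] * p"
  \<comment> \<open>Up to a constant factor this is u(1 - u) p w as a function of z. It is
    continuous on [a,b] and vanishes at both ends, as \<alpha> + 1 and \<beta> + 1 are
    positive.\<close>
  define F where "F z = (z - a) powr (\<alpha> + 1) * (b - z) powr (\<beta> + 1)
      * (poly p (unit z) * exp (- y * unit z))" for z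
  \<comment> \<open>The factor \<open>b - a\<close> is left over from the substitution: (z - a)(b -
    z) = (b - a)^2 u(1 - u), while d/dz = (b - a)^(-1) d/du.\<close>
  define f where "f z = (b - a) * (base z * (poly r (unit z) * exp (- y * unit z)))" for z
  have "(f has_integral (F b - F a)) {a..b}"
  \<comment> \<open>The powers in \<open>F\<close> need not be differentiable at the endpoints, so
    derivatives are taken only in the interior.\<close>
  proof (rule fundamental_theorem_of_calculus_interior)
    show "a \<le> b" using ab by simp
    show "continuous_on {a..b} F"
      unfolding F_def using \<alpha> \<beta> by (intro continuous_intros continuous_on_powr') auto
    fix z assume z: "z \<in> {a<..<b}"
    define d where "d = b - a"
    define v where "v = unit z"
    have d: "d > 0" and za: "z - a = d * v" and bz: "b - z = d * (1 - v)"
      using ab by (auto simp: d_def v_def unit_def field_simps)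
    have unit': "(unit has_real_derivative 1 / d) (at z)"
      unfolding unit_def d_def using ab by (auto intro!: derivative_eq_intros)
    have p': "((\<lambda>x. poly p (unit x)) has_real_derivative poly (pderiv p) v * (1 / d)) (at z)"
      unfolding v_def by (rule DERIV_chain2[OF poly_DERIV unit'])
    have e': "((\<lambda>x. exp (- y * unit x)) has_real_derivative exp (- y * v) * (- y * (1 / d))) (at z)"
      unfolding v_def by (rule derivative_eq_intros unit' refl)+ simp
    have "((\<lambda>x. (x - a) powr (\<alpha> + 1)) has_real_derivative (\<alpha> + 1) * (z - a) powr \<alpha>) (at z)"
      using z by (auto intro!: derivative_eq_intros simp: algebra_simps)
    moreover have "((\<lambda>x. (b - x) powr (\<beta> + 1)) has_real_derivative - (\<beta> + 1) * (b - z) powr \<beta>) (at z)"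
      using z by (auto intro!: derivative_eq_intros simp: algebra_simps)
    ultimately have "(F has_real_derivative
        ((\<alpha> + 1) * (z - a) powr \<alpha> * (b - z) powr (\<beta> + 1)
          + - (\<beta> + 1) * (b - z) powr \<beta> * (z - a) powr (\<alpha> + 1)) * (poly p v * exp (- y * v))
        + (poly (pderiv p) v * (1 / d) * exp (- y * v) + exp (- y * v) * (- y * (1 / d)) * poly p v)
          * ((z - a) powr (\<alpha> + 1) * (b - z) powr (\<beta> + 1))) (at z)"
      unfolding F_def v_def by (intro DERIV_mult p'[unfolded v_def] e'[unfolded v_def])
    also have "(z - a) powr (\<alpha> + 1) = (z - a) powr \<alpha> * (z - a)"
      using z by (simp add: powr_add)
    also have "(b - z) powr (\<beta> + 1) = (b - z) powr \<beta> * (b - z)"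
      using z by (simp add: powr_add)
    also have "((\<alpha> + 1) * (z - a) powr \<alpha> * ((b - z) powr \<beta> * (b - z))
          + - (\<beta> + 1) * (b - z) powr \<beta> * ((z - a) powr \<alpha> * (z - a))) * (poly p v * exp (- y * v))
        + (poly (pderiv p) v * (1 / d) * exp (- y * v) + exp (- y * v) * (- y * (1 / d)) * poly p v)
          * ((z - a) powr \<alpha> * (z - a) * ((b - z) powr \<beta> * (b - z)))
      = (z - a) powr \<alpha> * (b - z) powr \<beta> * exp (- y * v)
         * (((\<alpha> + 1) * (b - z) - (\<beta> + 1) * (z - a)) * poly p v
            + (poly (pderiv p) v - y * poly p v) * ((z - a) * (b - z) / d))"
      by (simp add: algebra_simps add_divide_distrib diff_divide_distrib)
    also have "((\<alpha> + 1) * (b - z) - (\<beta> + 1) * (z - a)) * poly p v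
            + (poly (pderiv p) v - y * poly p v) * ((z - a) * (b - z) / d)
        = d * poly r v"
    proof -
      have "poly r v = (1 - 2 * v) * poly p v + v * (1 - v) * poly (pderiv p) v
          + (\<alpha> - (\<alpha> + \<beta> + y) * v + y * v\<^sup>2) * poly p v"
        unfolding r_def pderiv_mult poly_add poly_mult
        by (simp add: pderiv_pCons algebra_simps power2_eq_square)
      moreover have "(z - a) * (b - z) / d = d * (v * (1 - v))"
        unfolding za bz using d by simp
      ultimately show ?thesis
        unfolding za bz by (simp only:) (simp add: algebra_simps power2_eq_square)
    qed
    finally have "(F has_real_derivative f z) (at z)"
      using z unfolding f_def base_def v_def d_def by (simp add: mult_ac)
    then show "(F has_vector_derivative f z) (at z)"
      by (simp add: has_real_derivative_iff_has_vector_derivative)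
  qed
  then have "(f has_integral 0) {a..b}" by (simp add: F_def)
  moreover have "(f has_integral (b - a) * moment y r) UNIV"
    unfolding f_def moment_def
    by (intro has_integral_mult_right has_integral_integral_lborel moment_integrable)
  moreover have "f = (\<lambda>z. if z \<in> {a..b} then f z else 0)"
    by (auto simp: f_def base_def)
  ultimately have "(f has_integral 0) UNIV" "(f has_integral (b - a) * moment y r) UNIV"
    using has_integral_restrict_UNIV[of "{a..b}" f 0] by simp_all
  then have "(b - a) * moment y r = 0"
    using has_integral_unique by blast
  then show ?thesis using ab by (simp add: r_def)
qed

sublocale moment_functional moment \<alpha> \<beta>
  by unfold_locales (fact moment_add moment_smult moment_pos moment_deriv moment_pearson)+

end

section \<open>The Vandermonde determinant in a monic basis\<close>

text \<open>The clauses on \<open>c m\<close> and on \<open>c k\<close> beyond \<open>m\<close> make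
  the matrix of coefficients unitriangular when each \<open>r\<close> is monic.\<close>

lemma monic_family_expand:
  fixes N :: "nat \<Rightarrow> real poly"
  assumes lead: "\<And>j. coeff (N j) j = 1" and gt: "\<And>i j. i > j \<Longrightarrow> coeff (N j) i = 0"
  shows "(\<And>i. i > m \<Longrightarrow> coeff r i = 0) \<Longrightarrow>
    \<exists>c. c m = coeff r m \<and> (\<forall>k>m. c k = 0) \<and> r = (\<Sum>k\<le>m. smult (c k) (N k))"
proof (induction m arbitrary: r)
  case 0
  have "r = smult (coeff r 0) (N 0)"
    by (rule poly_eqI) (metis 0 coeff_smult gt lead mult.right_neutral mult_zero_right neq0_conv)
  then show ?case by (intro exI[of _ "\<lambda>k. if k = 0 then coeff r 0 else 0"]) auto
next
  case (Suc m)
  define s where "s = r - smult (coeff r (Suc m)) (N (Suc m))"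
  have "coeff s i = 0" if "i > m" for i
    using that Suc.prems[of i] by (cases "i = Suc m") (auto simp: s_def lead gt)
  from Suc.IH[OF this] obtain c where c: "\<forall>k>m. c k = 0" "s = (\<Sum>k\<le>m. smult (c k) (N k))"
    by auto
  define d where "d = c(Suc m := coeff r (Suc m))"
  have "(\<Sum>k\<le>m. smult (d k) (N k)) = (\<Sum>k\<le>m. smult (c k) (N k))"
    by (rule sum.cong) (auto simp: d_def)
  then have "r = (\<Sum>k\<le>Suc m. smult (d k) (N k))"
    using c(2) by (simp add: s_def d_def algebra_simps)
  then show ?case using c(1) by (intro exI[of _ d]) (auto simp: d_def)
qed

text \<open>In the Newton basis \<open>\<Prod>k<j. (X - x k)\<close> the evaluation matrix is triangular, and
  every other family of monic polynomials is a unitriangular transform of it.\<close>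

lemma vandermonde_eq_sum_permutations:
  fixes P :: "nat \<Rightarrow> real poly" and x :: "nat \<Rightarrow> real"
  assumes lead: "\<And>j. coeff (P j) j = 1" and gt: "\<And>i j. i > j \<Longrightarrow> coeff (P j) i = 0"
  shows "(\<Sum>\<pi> | \<pi> permutes {0..<n}. signof \<pi> * (\<Prod>i = 0..<n. poly (P (\<pi> i)) (x i)))
    = (\<Prod>j<n. \<Prod>i<j. x j - x i)"
proof -
  define N where "N j = (\<Prod>k<j. [:- x k, 1:])" for j
  have deg: "degree (N j) = j" for j
    unfolding N_def by (simp add: degree_prod_eq_sum_degree)
  have N_lead: "coeff (N j) j = 1" for j
    using lead_coeff_prod[of "\<lambda>k. [:- x k, 1:]" "{..<j}"] deg[of j] unfolding N_def by simp
  have N_gt: "coeff (N j) i = 0" if "i > j" for i j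
    using that deg[of j] by (simp add: coeff_eq_0)
  have "\<exists>c. c j = 1 \<and> (\<forall>k>j. c k = 0) \<and> P j = (\<Sum>k\<le>j. smult (c k) (N k))" for j
    using monic_family_expand[where N = N and r = "P j" and m = j, OF N_lead N_gt gt] lead by auto
  then obtain c where c: "\<And>j. c j j = 1" "\<And>j k. k > j \<Longrightarrow> c j k = 0"
    "\<And>j. P j = (\<Sum>k\<le>j. smult (c j k) (N k))" by metis
  define A where "A = mat n n (\<lambda>(i, j). poly (P j) (x i))"
  define B where "B = mat n n (\<lambda>(i, j). poly (N j) (x i))"
  define C where "C = mat n n (\<lambda>(i, j). c j i)"
  have carrier: "A \<in> carrier_mat n n" "B \<in> carrier_mat n n" "C \<in> carrier_mat n n"
    by (simp_all add: A_def B_def C_def)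
  have "A = B * C"
  proof (rule eq_matI)
    fix i j assume "i < dim_row (B * C)" "j < dim_col (B * C)"
    then have ij: "i < n" "j < n" using carrier by auto
    have "(B * C) $$ (i, j) = (\<Sum>k = 0..<n. poly (N k) (x i) * c j k)"
      using ij by (simp add: B_def C_def scalar_prod_def)
    also have "\<dots> = (\<Sum>k\<le>j. poly (N k) (x i) * c j k)"
      using ij c(2) by (intro sum.mono_neutral_right) auto
    also have "\<dots> = A $$ (i, j)"
      using ij by (simp add: A_def c(3)[of j] poly_sum mult.commute)
    finally show "A $$ (i, j) = (B * C) $$ (i, j)" ..
  qed (use carrier in auto)
  then have "det A = det B * det C" using det_mult carrier by blast
  moreover have "det C = 1"
  proof -
    have "upper_triangular C" by (auto simp: C_def upper_triangular_def c(2))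
    moreover have "diag_mat C = map (\<lambda>i. 1) [0..<n]"
      by (simp add: diag_mat_def C_def c(1))
    ultimately show ?thesis using det_upper_triangular[OF _ carrier(3)]
      by (simp add: prod_list_replicate map_replicate_const)
  qed
  moreover have "det B = (\<Prod>j<n. \<Prod>i<j. x j - x i)"
  proof -
    have eval: "poly (N j) (x i) = (\<Prod>k<j. x i - x k)" for i j
      by (simp add: N_def poly_prod)
    have "det B = prod_list (diag_mat B)"
      by (rule det_lower_triangular[OF _ carrier(2)]) (auto simp: B_def eval intro!: prod_zero)
    also have "\<dots> = (\<Prod>j<n. \<Prod>i<j. x j - x i)"
      by (simp add: prod_list_diag_prod B_def eval atLeast0LessThan)
    finally show ?thesis .
  qed
  moreover have "det A = (\<Sum>\<pi> | \<pi> permutes {0..<n}. signof \<pi> * (\<Prod>i = 0..<n. poly (P (\<pi> i)) (x i)))"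
    unfolding det_def'[OF carrier(1)]
  proof (rule sum.cong)
    fix \<pi> assume "\<pi> \<in> {\<pi>. \<pi> permutes {0..<n}}"
    then have "\<pi> i < n" if "i < n" for i using that by (auto dest: permutes_in_image)
    then show "signof \<pi> * (\<Prod>i = 0..<n. A $$ (i, \<pi> i))
        = signof \<pi> * (\<Prod>i = 0..<n. poly (P (\<pi> i)) (x i))" by (simp add: A_def)
  qed simp
  ultimately show ?thesis by simp
qed

text \<open>Squaring removes the sign of the reversed differences; the shift moves the indices to
  {0..<n}, the range of the degrees.\<close>

lemma vandermonde_sq:
  "(vandermonde n z)\<^sup>2 = (\<Prod>j<n. \<Prod>i<j. z (Suc j) - z (Suc i))\<^sup>2"
proof -
  have "vandermonde n z = (\<Prod>j<n. \<Prod>i<j. z (Suc i) - z (Suc j))"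
  proof -
    have "(\<Prod>i\<in>{1..<Suc j}. z i - z (Suc j)) = (\<Prod>i<j. z (Suc i) - z (Suc j))" for j
      by (rule prod.reindex_bij_witness[of _ Suc "\<lambda>i. i - 1"]) auto
    then show ?thesis unfolding vandermonde_def
      by (simp only: One_nat_def prod.atLeast1_atMost_eq)
  qed
  then show ?thesis by (simp add: prod_power_distrib power2_commute)
qed

section \<open>Heine's formula\<close>

context jacobi_weight
begin

text \<open>The hypothesis supplies the extensionality outside {1..n} that \<open>cube\<close>
  demands and the product of indicators cannot see.\<close>

lemma indicator_cube_prod:
  assumes "z \<in> space (lebesgue_pow n)"
  shows "indicator (cube n a b) z = (\<Prod>k\<in>{1..n}. indicator {a..b} (z k) :: real)"
proof (cases "z \<in> cube n a b")
  case True
  then show ?thesis by (auto simp: cube_def PiE_iff)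
next
  case False
  then obtain k where "k \<in> {1..n}" "z k \<notin> {a..b}"
    using assms by (auto simp: cube_def PiE_iff lebesgue_pow_def space_PiM)
  then have "(\<Prod>k\<in>{1..n}. indicator {a..b} (z k) :: real) = 0"
    by (intro prod_zero bexI[of _ k]) auto
  then show ?thesis using False by simp
qed

definition one_weight :: "real \<Rightarrow> real \<Rightarrow> real" where
  "one_weight y z = base z * exp (- y * unit z)"

text \<open>With z = a + (b - a) u one has (x + \<gamma>) z = a (x + \<gamma>) - y u.\<close>

lemma indicator_weight:
  assumes "y = - (b - a) * (x + \<gamma>)"
  shows "indicator {a..b} z * (exp (x * z) * weight a b \<alpha> \<beta> \<gamma> z)
    = exp (a * (x + \<gamma>)) * one_weight y z"
proof -
  have "a * (x + \<gamma>) + - y * unit z = (x + \<gamma>) * z"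
    using ab unfolding assms unit_def by (simp add: field_simps)
  then have "exp (a * (x + \<gamma>)) * exp (- y * unit z) = exp (x * z) * exp (\<gamma> * z)"
    unfolding exp_add[symmetric] by (simp add: algebra_simps)
  then show ?thesis by (simp add: weight_def one_weight_def base_def mult_ac)
qed

text \<open>Each factor of the square is expanded over its own permutation, so every term is a
  product over the coordinates. The parameter \<open>y\<close> is free, as any monic family gives
  the same determinant.\<close>

lemma vandermonde_sq_ortho_poly:
  "(vandermonde n z)\<^sup>2 = (\<Prod>j<n. \<Prod>i<j. b - a)\<^sup>2
     * (\<Sum>\<pi> | \<pi> permutes {0..<n}. \<Sum>\<rho> | \<rho> permutes {0..<n}. signof \<pi> * signof \<rho> *
        (\<Prod>k\<in>{1..n}. poly (ortho_poly y (\<pi> (k - 1)) * ortho_poly y (\<rho> (k - 1))) (unit (z k))))"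
proof -
  have diff: "z (Suc j) - z (Suc i) = (b - a) * (unit (z (Suc j)) - unit (z (Suc i)))" for i j
    using ab by (simp add: unit_def diff_divide_distrib[symmetric])
  define S where "S = (\<Sum>\<pi> | \<pi> permutes {0..<n}.
      signof \<pi> * (\<Prod>i = 0..<n. poly (ortho_poly y (\<pi> i)) (unit (z (Suc i)))))"
  have "S = (\<Prod>j<n. \<Prod>i<j. unit (z (Suc j)) - unit (z (Suc i)))"
    unfolding S_def
    by (rule vandermonde_eq_sum_permutations[where x = "\<lambda>i. unit (z (Suc i))"])
      (auto simp: coeff_ortho_poly_gt)
  then have "(vandermonde n z)\<^sup>2 = (\<Prod>j<n. \<Prod>i<j. b - a)\<^sup>2 * S\<^sup>2"
    unfolding vandermonde_sq diff by (simp add: prod.distrib power_mult_distrib)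
  also have "S\<^sup>2 = (\<Sum>\<pi> | \<pi> permutes {0..<n}. \<Sum>\<rho> | \<rho> permutes {0..<n}. signof \<pi> * signof \<rho> *
      (\<Prod>i = 0..<n. poly (ortho_poly y (\<pi> i) * ortho_poly y (\<rho> i)) (unit (z (Suc i)))))"
    unfolding S_def power2_eq_square sum_product by (simp add: prod.distrib mult_ac)
  also have "\<dots> = (\<Sum>\<pi> | \<pi> permutes {0..<n}. \<Sum>\<rho> | \<rho> permutes {0..<n}. signof \<pi> * signof \<rho> *
        (\<Prod>k\<in>{1..n}. poly (ortho_poly y (\<pi> (k - 1)) * ortho_poly y (\<rho> (k - 1))) (unit (z k))))"
    unfolding One_nat_def prod.atLeast1_atMost_eq by (simp add: atLeast0LessThan)
  finally show ?thesis .
qed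

text \<open>Fubini turns each term of the double sum into a product of moments. By orthogonality
  only \<pi> = \<rho> contributes, and each of the n! permutations gives h_0 ... h_(n-1).\<close>

lemma heine:
  fixes x \<gamma> :: real and n :: nat
  defines "y \<equiv> - (b - a) * (x + \<gamma>)"
  shows "set_integrable (lebesgue_pow n) (cube n a b) (integrand n a b \<alpha> \<beta> \<gamma> x)" (is ?int)
    and "partition_fun n a b \<alpha> \<beta> \<gamma> x =
      (\<Prod>j<n. \<Prod>i<j. b - a)\<^sup>2 * exp (a * (x + \<gamma>)) ^ n * fact n * (\<Prod>j<n. sqnorm y j)" (is ?eq)
proof -
  interpret product_sigma_finite "\<lambda>k :: nat. lborel :: real measure" by standard
  let ?K = "(\<Prod>j<n. \<Prod>i<j. b - a)\<^sup>2" and ?E = "exp (a * (x + \<gamma>)) ^ n"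
  let ?perms = "{\<pi>. \<pi> permutes {0..<n}}"
  \<comment> \<open>Coordinates run over {1..n}, degrees over {0..<n}; hence
    \<open>k - 1\<close>.\<close>
  define q where "q \<pi> \<rho> k = ortho_poly y (\<pi> (k - 1)) * ortho_poly y (\<rho> (k - 1))"
    for \<pi> \<rho> :: "nat \<Rightarrow> nat" and k
  define T where "T \<pi> \<rho> z =
      (\<Prod>k\<in>{1..n}. base (z k) * (poly (q \<pi> \<rho> k) (unit (z k)) * exp (- y * unit (z k))))"
    for \<pi> \<rho> z
  define F where "F z = ?K * ?E * (\<Sum>\<pi>\<in>?perms. \<Sum>\<rho>\<in>?perms. signof \<pi> * signof \<rho> * T \<pi> \<rho> z)" for z
  have fin: "finite ?perms" by (rule finite_permutations) simp
  have eq: "indicator (cube n a b) z *\<^sub>R integrand n a b \<alpha> \<beta> \<gamma> x z = F z"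
    if z: "z \<in> space (lebesgue_pow n)" for z
  proof -
    have "indicator (cube n a b) z *\<^sub>R integrand n a b \<alpha> \<beta> \<gamma> x z
        = (vandermonde n z)\<^sup>2 *
          (\<Prod>k\<in>{1..n}. indicator {a..b} (z k) * (exp (x * z k) * weight a b \<alpha> \<beta> \<gamma> (z k)))"
      unfolding integrand_def indicator_cube_prod[OF z] by (simp add: prod.distrib)
    also have "\<dots> = (vandermonde n z)\<^sup>2 * ?E * (\<Prod>k\<in>{1..n}. one_weight y (z k))"
      unfolding indicator_weight[OF y_def[THEN meta_eq_to_obj_eq]] by (simp add: prod.distrib)
    also have "\<dots> = F z"
      unfolding vandermonde_sq_ortho_poly[of n z y] F_def T_def q_def one_weight_def
      by (simp add: prod.distrib sum_distrib_right sum_distrib_left mult_ac)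
    finally show ?thesis .
  qed
  have T_int: "integrable (lebesgue_pow n) (T \<pi> \<rho>)" for \<pi> \<rho>
    unfolding lebesgue_pow_def T_def
    by (rule product_integrable_prod) (simp, rule moment_integrable)
  have F_int: "integrable (lebesgue_pow n) F"
    unfolding F_def by (intro integrable_mult_right Bochner_Integration.integrable_sum T_int)
  show ?int
    unfolding set_integrable_def
    by (subst Bochner_Integration.integrable_cong[OF refl eq]) (use F_int in auto)
  have T_val: "(\<integral>z. T \<pi> \<rho> z \<partial>lebesgue_pow n) = (if \<pi> = \<rho> then \<Prod>j<n. sqnorm y j else 0)"
    if "\<pi> \<in> ?perms" "\<rho> \<in> ?perms" for \<pi> \<rho>
  proof -
    have "(\<integral>z. T \<pi> \<rho> z \<partial>lebesgue_pow n) = (\<Prod>k\<in>{1..n}. moment y (q \<pi> \<rho> k))"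
      unfolding lebesgue_pow_def T_def moment_def
      by (rule product_integral_prod) (simp, rule moment_integrable)
    also have "\<dots> = (\<Prod>i<n. if \<pi> i = \<rho> i then sqnorm y (\<pi> i) else 0)"
      unfolding q_def L_ortho_poly_ortho_poly One_nat_def prod.atLeast1_atMost_eq
      by (simp only: diff_Suc_Suc diff_zero)
    also have "\<dots> = (if \<pi> = \<rho> then \<Prod>j<n. sqnorm y j else 0)"
    proof (cases "\<pi> = \<rho>")
      case True
      have "(\<Prod>i<n. sqnorm y (\<pi> i)) = (\<Prod>j<n. sqnorm y j)"
        using prod.permute[of \<pi> "{0..<n}" "sqnorm y"] that(1)
        by (simp add: o_def atLeast0LessThan)
      then show ?thesis using True by simp
    next
      case False
      \<comment> \<open>Both permutations fix everything outside {0..<n}, so they differ at a point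
        inside, which gives a vanishing factor.\<close>
      then obtain i where i: "\<pi> i \<noteq> \<rho> i" by auto
      then have "i < n" using that by (metis atLeastLessThan_iff mem_Collect_eq permutes_not_in zero_le)
      then show ?thesis using False i by (auto intro!: prod_zero)
    qed
    finally show ?thesis .
  qed
  have "partition_fun n a b \<alpha> \<beta> \<gamma> x = (\<integral>z. F z \<partial>lebesgue_pow n)"
    unfolding partition_fun_def set_lebesgue_integral_def
    by (rule Bochner_Integration.integral_cong[OF refl eq])
  also have "\<dots> = ?K * ?E * (\<Sum>\<pi>\<in>?perms. \<Sum>\<rho>\<in>?perms.
      signof \<pi> * signof \<rho> * (\<integral>z. T \<pi> \<rho> z \<partial>lebesgue_pow n))"
    unfolding F_def
    by (simp only: integral_mult_right_zero Bochner_Integration.integral_sum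
        Bochner_Integration.integrable_sum integrable_mult_right T_int)
  also have "\<dots> = ?K * ?E * (\<Sum>\<pi>\<in>?perms. \<Prod>j<n. sqnorm y j)"
  proof -
    have "(\<Sum>\<rho>\<in>?perms. signof \<pi> * signof \<rho> * (\<integral>z. T \<pi> \<rho> z \<partial>lebesgue_pow n))
        = (\<Prod>j<n. sqnorm y j)"
      if \<pi>: "\<pi> \<in> ?perms" for \<pi>
    proof -
      have "(\<Sum>\<rho>\<in>?perms. signof \<pi> * signof \<rho> * (\<integral>z. T \<pi> \<rho> z \<partial>lebesgue_pow n))
          = (\<Sum>\<rho>\<in>?perms. if \<pi> = \<rho> then signof \<pi> * signof \<pi> * (\<Prod>j<n. sqnorm y j) else 0)"
        using \<pi> by (intro sum.cong) (auto simp: T_val)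
      also have "\<dots> = signof \<pi> * signof \<pi> * (\<Prod>j<n. sqnorm y j)"
        using \<pi> fin by simp
      also have "signof \<pi> * signof \<pi> = (1 :: real)" by (simp add: sign_def)
      finally show ?thesis by simp
    qed
    then show ?thesis by simp
  qed
  also have "\<dots> = ?K * ?E * fact n * (\<Prod>j<n. sqnorm y j)"
    using card_permutations[of "{0..<n}" n] by simp
  finally show ?eq .
qed

section \<open>Logarithmic derivative of the integral and the function f\<close>

lemma partition_fun_pos: "partition_fun n a b \<alpha> \<beta> \<gamma> x > 0"
  unfolding heine(2) using ab sqnorm_pos by (intro mult_pos_pos prod_pos zero_less_power) auto

lemma sum_rec_a: "(\<Sum>j<n. rec_a y j) = - sub_p y n"
  by (induction n) auto

text \<open>Heine's formula makes the logarithm a sum. The exponential prefactor contributes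
  \<open>n * a\<close>; each ln h_j contributes (b - a) a_j since dy/dx = -(b - a), and the a_j add
  up to -p_n.\<close>

lemma ln_partition_fun_deriv:
  "((\<lambda>t. ln (partition_fun n a b \<alpha> \<beta> \<gamma> t)) has_real_derivative
     n * a - (b - a) * sub_p (- (b - a) * (x + \<gamma>)) n) (at x)"
proof -
  let ?y = "\<lambda>t. - (b - a) * (t + \<gamma>)"
  let ?K = "(\<Prod>j<n. \<Prod>i<j. b - a)\<^sup>2"
  have K: "?K > 0" using ab by (intro zero_less_power prod_pos) auto
  have "ln (partition_fun n a b \<alpha> \<beta> \<gamma> t)
      = ln (?K * fact n) + n * (a * (t + \<gamma>)) + (\<Sum>j<n. ln (sqnorm (?y t) j))" for t
  proof -
    have pos: "(\<Prod>j<n. sqnorm (?y t) j) > 0" using sqnorm_pos by (intro prod_pos) auto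
    have "partition_fun n a b \<alpha> \<beta> \<gamma> t
        = (?K * fact n) * exp (n * (a * (t + \<gamma>))) * (\<Prod>j<n. sqnorm (?y t) j)"
      unfolding heine(2) by (simp add: exp_of_nat_mult[symmetric] mult_ac)
    moreover have "?K * fact n > 0" using K by simp
    ultimately have "ln (partition_fun n a b \<alpha> \<beta> \<gamma> t)
        = ln (?K * fact n) + n * (a * (t + \<gamma>)) + ln (\<Prod>j<n. sqnorm (?y t) j)"
      using pos by (simp only: ln_mult_pos mult_pos_pos exp_gt_zero ln_exp)
    also have "ln (\<Prod>j<n. sqnorm (?y t) j) = (\<Sum>j<n. ln (sqnorm (?y t) j))"
      by (rule ln_prod) (use sqnorm_pos in \<open>auto simp: less_imp_neq[symmetric]\<close>)
    finally show ?thesis .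
  qed
  moreover have "((\<lambda>t. ln (?K * fact n) + n * (a * (t + \<gamma>)) + (\<Sum>j<n. ln (sqnorm (?y t) j)))
      has_real_derivative 0 + n * a + (\<Sum>j<n. (b - a) * rec_a (?y x) j)) (at x)"
  proof (intro DERIV_add DERIV_const DERIV_sum)
    show "((\<lambda>t. n * (a * (t + \<gamma>))) has_real_derivative n * a) (at x)"
      by (auto intro!: derivative_eq_intros)
    fix j
    have "(?y has_real_derivative - (b - a)) (at x)"
      by (auto intro!: derivative_eq_intros)
    from DERIV_chain2[OF sqnorm_deriv this]
    have "((\<lambda>t. sqnorm (?y t) j) has_real_derivative - rec_a (?y x) j * sqnorm (?y x) j * - (b - a)) (at x)" .
    from DERIV_chain2[OF DERIV_ln[OF sqnorm_pos] this]
    show "((\<lambda>t. ln (sqnorm (?y t) j)) has_real_derivative (b - a) * rec_a (?y x) j) (at x)"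
      by (rule DERIV_cong) (use sqnorm_pos[of "?y x" j] in \<open>simp add: field_simps\<close>)
  qed
  ultimately show ?thesis
    by (simp add: sum_distrib_left[symmetric] sum_rec_a)
qed

text \<open>The argument of \<open>g_fun\<close> inverts y = -(b - a)(x + \<gamma>), and the
  subtracted \<open>n * a\<close> cancels the contribution of the exponential prefactor.\<close>

lemma f_fun_eq: "f_fun n a b \<alpha> \<beta> \<gamma> = (\<lambda>y. real n * (real n + \<alpha> + \<beta>) + y * sub_p y n)"
proof
  fix y
  have "- (b - a) * (- y / (b - a) - \<gamma> + \<gamma>) = y"
    using ab by (simp add: divide_simps) (simp add: algebra_simps)
  then have "g_fun n a b \<alpha> \<beta> \<gamma> (- y / (b - a) - \<gamma>) = n * a - (b - a) * sub_p y n"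
    unfolding g_fun_def using DERIV_imp_deriv[OF ln_partition_fun_deriv] by metis
  then show "f_fun n a b \<alpha> \<beta> \<gamma> y = real n * (real n + \<alpha> + \<beta>) + y * sub_p y n"
    using ab by (simp add: f_fun_def)
qed

lemma f_fun_deriv: "(f_fun n a b \<alpha> \<beta> \<gamma> has_real_derivative phi y n) (at y)"
  unfolding f_fun_eq phi_def by (auto intro!: derivative_eq_intros sub_p_deriv)

lemma phi_deriv:
  "((\<lambda>t. phi t n) has_real_derivative rec_b y n * (X_fun y n - X_fun y (n - 1))) (at y)"
  unfolding phi_def rec_b_deriv_X[symmetric]
  by (auto intro!: derivative_eq_intros sub_p_deriv rec_b_deriv)

end

section \<open>The Painleve equation\<close>

lemma deriv_P_poly: "deriv P_poly = (\<lambda>y. 1)"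
  by (auto simp: P_poly_def[abs_def] intro!: DERIV_imp_deriv)

lemma deriv_Q_poly: "deriv (Q_poly n \<alpha> \<beta>) = (\<lambda>y. (- y + (2 * real n + \<alpha> - \<beta>)) / 2)"
proof
  fix y
  show "deriv (Q_poly n \<alpha> \<beta>) y = (- y + (2 * real n + \<alpha> - \<beta>)) / 2"
    unfolding Q_poly_def[abs_def] by (rule DERIV_imp_deriv) (auto intro!: derivative_eq_intros simp: field_simps)
qed

lemma deriv2_Q_poly: "deriv (deriv (Q_poly n \<alpha> \<beta>)) = (\<lambda>y. - 1 / 2)"
proof
  fix y
  show "deriv (deriv (Q_poly n \<alpha> \<beta>)) y = - 1 / 2"
    unfolding deriv_Q_poly by (rule DERIV_imp_deriv) (auto intro!: derivative_eq_intros)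
qed

lemma deriv_R_poly: "deriv (R_poly n \<alpha> \<beta>) = (\<lambda>y. - \<beta> * real n / 2)"
proof
  fix y
  show "deriv (R_poly n \<alpha> \<beta>) y = - \<beta> * real n / 2"
    unfolding R_poly_def[abs_def] by (rule DERIV_imp_deriv) (auto intro!: derivative_eq_intros)
qed

text \<open>Integral, logarithm and \<open>deriv\<close> are total functions; the first conjunct and
  the differentiability claims ensure that no default value enters the equation.\<close>

theorem theorem1p5:
  fixes n :: nat and a b \<alpha> \<beta> \<gamma> :: real
  assumes "n \<ge> 1" and "a < b" and "\<alpha> > -1" and "\<beta> > -1"
  shows "(\<forall>x. set_integrable (lebesgue_pow n) (cube n a b) (integrand n a b \<alpha> \<beta> \<gamma> x)
            \<and> partition_fun n a b \<alpha> \<beta> \<gamma> x > 0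
            \<and> (\<lambda>t. ln (partition_fun n a b \<alpha> \<beta> \<gamma> t)) differentiable at x)
       \<and> (\<forall>y. y \<noteq> 0 \<longrightarrow>
            f_fun n a b \<alpha> \<beta> \<gamma> differentiable at y
            \<and> deriv (f_fun n a b \<alpha> \<beta> \<gamma>) differentiable at y
            \<and> painleve_eq_at P_poly (Q_poly n \<alpha> \<beta>) (R_poly n \<alpha> \<beta>) (- 1 / 4 * \<beta>\<^sup>2 * (real n)\<^sup>2)
                (f_fun n a b \<alpha> \<beta> \<gamma>) y)"
proof -
  interpret jacobi_weight a b \<alpha> \<beta> by unfold_locales (use assms in auto)
  have f': "deriv (f_fun n a b \<alpha> \<beta> \<gamma>) = (\<lambda>y. phi y n)"
    using DERIV_imp_deriv[OF f_fun_deriv] by blast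
  have "painleve_eq_at P_poly (Q_poly n \<alpha> \<beta>) (R_poly n \<alpha> \<beta>) (- 1 / 4 * \<beta>\<^sup>2 * (real n)\<^sup>2)
      (f_fun n a b \<alpha> \<beta> \<gamma>) y" if "y \<noteq> 0" for y
  proof -
    define f f1 f2 where "f = f_fun n a b \<alpha> \<beta> \<gamma> y" and "f1 = phi y n"
      and "f2 = rec_b y n * (X_fun y n - X_fun y (n - 1))"
    have f2: "deriv (\<lambda>y. phi y n) y = f2"
      unfolding f2_def by (rule DERIV_imp_deriv[OF phi_deriv])
    have "y\<^sup>2 * f2\<^sup>2 = ((2 * real n + \<alpha> + \<beta> - y) * f1 + f - real n * \<beta>)\<^sup>2
        - 4 * (y * f1 - f + real n * (real n + \<alpha> + \<beta>)) * f1 * (f1 - \<beta>)"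
      using sigma_form[of y n] unfolding f_def f1_def f2_def f_fun_eq by simp
    then have "f2\<^sup>2 = (((2 * real n + \<alpha> + \<beta> - y) * f1 + f - real n * \<beta>)\<^sup>2
        - 4 * (y * f1 - f + real n * (real n + \<alpha> + \<beta>)) * f1 * (f1 - \<beta>)) / y\<^sup>2"
      using that by (simp add: eq_divide_eq mult.commute)
    \<comment> \<open>\<open>P_poly\<close> is the identity, so its second and third derivatives
      vanish; clearing y^2 leaves the expanded \<open>sigma_form\<close>.\<close>
    then show ?thesis
      unfolding painleve_eq_at_def f' f2 deriv2_Q_poly deriv_Q_poly deriv_R_poly deriv_P_poly
        f_def[symmetric] f1_def[symmetric] P_poly_def Q_poly_def R_poly_def
      using that
      by (simp add: divide_simps) (simp add: algebra_simps power2_eq_square power3_eq_cube)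
  qed
  moreover have "(\<lambda>t. ln (partition_fun n a b \<alpha> \<beta> \<gamma> t)) differentiable at x" for x
    using ln_partition_fun_deriv real_differentiable_def by blast
  moreover have "f_fun n a b \<alpha> \<beta> \<gamma> differentiable at y" "(\<lambda>y. phi y n) differentiable at y" for y
    using f_fun_deriv phi_deriv real_differentiable_def by blast+
  ultimately show ?thesis
    unfolding f' using heine(1) partition_fun_pos by blast
qed

end
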